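(* If $k\in\mathbb{N}$ and $Y_t=e^{B_t+kt}$, then for $\lambda>0$, $\gamma>0$, $$\mathbb{E}\exp\Bigl(-\gamma Y_t-\frac{\lambda^2}{2}\int_0^tY_u^2\,du\Bigr)=(-1)^k e^{\frac{k^2}{2}t}\,\frac{\partial^{k}p(\gamma,\lambda)}{\partial\gamma^k},$$ where $p(\gamma,\lambda)=\mathbb{E}\,e^{-\lambda\cosh(\operatorname{arcosh}(\gamma/\lambda)+B_t)}$.
   Context: $B$ is a standard Brownian motion and $t$ is a fixed (deterministic) time. $\operatorname{arcosh}$ denotes the inverse function of $\cosh$, $\operatorname{arcosh}(y)=\ln\bigl(y+\sqrt{y^2-1}\bigr)$.
   Formalization: The factor e^{k²t/2} is corrected to e^{-k²t/2}; the printed sign fails for every k≥1, t>0, its right side being e^{k²t} times the left. For γ<λ, arcosh is read as the given formula with complex principal branches. *)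

theory Defs
  imports "HOL-Probability.Probability"
begin

text \<open>
  The time set is \<open>[0, \<infinity>)\<close>; the values \<open>B s\<close> for \<open>s < 0\<close> are irrelevant.  All paths are required to
  be continuous, so that path integrals such as \<open>\<integral>\<^sub>0\<^sup>t f (B u) du\<close> are random variables without
  assuming the probability space complete.
\<close>

definition standard_brownian_motion :: "'a measure \<Rightarrow> (real \<Rightarrow> 'a \<Rightarrow> real) \<Rightarrow> bool" where
  "standard_brownian_motion M B \<longleftrightarrow>
     prob_space M \<and>
     (\<forall>s\<ge>0. B s \<in> borel_measurable M) \<and>
     (\<forall>\<omega>\<in>space M. B 0 \<omega> = 0) \<and>
     (\<forall>(n::nat) (\<tau> :: nat \<Rightarrow> real). 0 \<le> \<tau> 0 \<and> (\<forall>i<n. \<tau> i < \<tau> (Suc i)) \<longrightarrow>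
        prob_space.indep_vars M (\<lambda>_. borel) (\<lambda>i \<omega>. B (\<tau> (Suc i)) \<omega> - B (\<tau> i) \<omega>) {..<n}) \<and>
     (\<forall>s\<ge>0. \<forall>u>s. distributed M lborel (\<lambda>\<omega>. B u \<omega> - B s \<omega>) (normal_density 0 (sqrt (u - s)))) \<and>
     (\<forall>\<omega>\<in>space M. continuous_on {0..} (\<lambda>s. B s \<omega>))"

text \<open>
  \<open>cosh_kernel l x g\<close> is \<open>exp (- l cosh (arcosh (g / l) + x))\<close>.  It is complex-valued because
  \<open>arcosh (g / l)\<close> is not real for \<open>0 < g < l\<close>; the complex \<^const>\<open>arcosh\<close> is the same formula
  \<open>ln (y + sqrt (y\<^sup>2 - 1))\<close> with principal branches.  For \<open>g \<ge> l > 0\<close> it is the real expression, see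
  \<open>cosh_kernel_real\<close> below.
\<close>

definition cosh_kernel :: "real \<Rightarrow> real \<Rightarrow> real \<Rightarrow> complex" where
  "cosh_kernel l x g =
     exp (- complex_of_real l * cosh (arcosh (complex_of_real (g / l)) + complex_of_real x))"

definition cosh_transform :: "'a measure \<Rightarrow> ('a \<Rightarrow> real) \<Rightarrow> real \<Rightarrow> real \<Rightarrow> complex" where
  "cosh_transform M X g l = (LINT \<omega>|M. cosh_kernel l (X \<omega>) g)"

definition nth_vector_derivative ::
    "nat \<Rightarrow> (real \<Rightarrow> 'b::real_normed_vector) \<Rightarrow> real \<Rightarrow> 'b" where
  "nth_vector_derivative n f = ((\<lambda>h x. vector_derivative h (at x)) ^^ n) f"

lemma arcosh_complex_of_real:
  assumes "y \<ge> 1"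
  shows "arcosh (complex_of_real y) = complex_of_real (arcosh y)"
proof -
  have sq: "y\<^sup>2 - 1 \<ge> 0"
    using assms by simp
  have "(complex_of_real y ^ 2 - 1) powr complex_of_real (1/2)
      = complex_of_real ((y\<^sup>2 - 1) powr (1/2))"
    using powr_of_real[OF sq, of "1/2"] by simp
  moreover have "y + (y\<^sup>2 - 1) powr (1/2) > 0"
    using assms by (simp add: add_pos_nonneg)
  ultimately show ?thesis
    unfolding arcosh_def by (simp add: Ln_of_real flip: of_real_add)
qed

lemma cosh_kernel_real:
  assumes "0 < l" "l \<le> g"
  shows "cosh_kernel l x g = complex_of_real (exp (- l * cosh (arcosh (g / l) + x)))"
proof -
  have "g / l \<ge> 1"
    using assms by simp
  hence "arcosh (complex_of_real (g / l)) = complex_of_real (arcosh (g / l))"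
    by (rule arcosh_complex_of_real)
  hence "cosh_kernel l x g
      = exp (- complex_of_real l * cosh (complex_of_real (arcosh (g / l) + x)))"
    unfolding cosh_kernel_def by simp
  also have "cosh (complex_of_real (arcosh (g / l) + x)) = complex_of_real (cosh (arcosh (g / l) + x))"
    by (simp only: cosh_def exp_of_real of_real_minus[symmetric] scaleR_conv_of_real of_real_add[symmetric]
          of_real_mult[symmetric] of_real_eq_id id_apply)
  finally show ?thesis
    by (simp only: exp_of_real of_real_minus[symmetric] of_real_mult[symmetric])
qed

end

theory Submission
  imports Defs
begin

text \<open>
  Write \<open>A = \<integral>\<^sub>0\<^sup>t exp (2 B u) du\<close>, and let \<open>s = \<lambda> sinh (arcosh (\<gamma> / \<lambda>))\<close>, a real or imaginary
  square root of \<open>\<gamma>\<^sup>2 - \<lambda>\<^sup>2\<close>.  Since \<open>\<lambda> cosh (arcosh (\<gamma> / \<lambda>) + b) = \<gamma> cosh b + s sinh b\<close>, the function \<open>p\<close> is the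
  expectation of \<open>\<phi> 0 (B t)\<close>, where
  \<open>\<phi> x b = exp (- exp x (\<gamma> cosh b + s sinh b))\<close>.  Three facts combine.

  \<^item> For drift zero, \<open>E exp (- \<gamma> exp (B t) - \<lambda>\<^sup>2 / 2 A) = p \<gamma> \<lambda>\<close>.  A direct computation gives
    \<open>1/2 \<phi>\<^sub>x\<^sub>x - \<lambda>\<^sup>2 / 2 exp (2 x) \<phi> = 1/2 \<phi>\<^sub>b\<^sub>b\<close>, so the semigroup with killing rate
    \<open>\<lambda>\<^sup>2 / 2 exp (2 x)\<close>, run in the variable \<open>x\<close>, has the same effect on \<open>\<phi>\<close> as the heat semigroup,
    run in the variable \<open>b\<close>.  At \<open>x = b = 0\<close> the first gives the left side, because
    \<open>\<phi> x 0 = exp (- \<gamma> exp x)\<close>, and the second gives the right side.  To make this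
    precise, sample the Brownian path at times \<open>j h\<close>, \<open>h = t / n\<close>.  For one Gaussian step
    the two evolutions differ by \<open>O(h powr (3/2))\<close> uniformly in \<open>x\<close> and \<open>b\<close>
    (\<open>swap_kernel_one_step\<close>), errors add up over \<open>n\<close> steps since both evolutions are contractions
    (\<open>duality\<close>), and \<open>n h powr (3/2)\<close> tends to \<open>0\<close> (\<open>exp_functional_swap\<close>).

  \<^item> The left side for drift zero is a Laplace transform in \<open>\<gamma>\<close>, so its \<open>k\<close>-th derivative is
    \<open>(-1)\<^sup>k E (exp (k B t) exp (- \<gamma> exp (B t) - \<lambda>\<^sup>2 / 2 A))\<close> (\<open>Laplace_moment_derivative\<close>).  By the
    first fact this is also the \<open>k\<close>-th derivative of \<open>p\<close>.

  \<^item> By the Cameron--Martin formula, the weight \<open>exp (k B t - k\<^sup>2 t / 2)\<close> turns \<open>B u\<close> into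
    \<open>B u + k u\<close>.  For the functionals at hand it also follows from the sampled path, where
    it is a shift of the Gaussian density at each step (\<open>exp_functional_Cameron_Martin\<close>).  This is
    where the factor \<open>exp (- k\<^sup>2 t / 2)\<close> comes from.
\<close>

section \<open>Weighted random walks and their transition operators\<close>

text \<open>
  One step of a walk with increment law \<open>N\<close> that starts at \<open>x\<close> and survives with
  probability \<open>w x\<close>; the survival weight is taken at the starting point, as in a left Riemann sum.
\<close>

definition walk_step :: "(real \<Rightarrow> real) \<Rightarrow> real measure \<Rightarrow> (real \<Rightarrow> 'b) \<Rightarrow> real
    \<Rightarrow> 'b::{banach, second_countable_topology}" where
  "walk_step w N f x = w x *\<^sub>R (\<integral>y. f (x + y) \<partial>N)"

lemma (in real_distribution) integrable_bounded_borel: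
  fixes f :: "real \<Rightarrow> 'b::{banach, second_countable_topology}"
  assumes "f \<in> borel_measurable borel" and "\<And>x. norm (f x) \<le> c"
  shows "integrable M f"
  using assms by (intro integrable_const_bound[where B = c]) auto

lemma (in real_distribution) walk_step_bounded_borel:
  fixes f :: "real \<Rightarrow> 'b::{banach, second_countable_topology}"
  assumes w [measurable]: "w \<in> borel_measurable borel" and w01: "\<And>x. 0 \<le> w x" "\<And>x. w x \<le> 1"
    and f [measurable]: "f \<in> borel_measurable borel" and bd: "\<And>x. norm (f x) \<le> c"
  shows "walk_step w M f \<in> borel_measurable borel" and "norm (walk_step w M f x) \<le> c"
proof -
  show "walk_step w M f \<in> borel_measurable borel"
    unfolding walk_step_def by measurable
  have int: "integrable M (\<lambda>y. f (x + y))"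
    by (rule integrable_bounded_borel[OF _ bd]) measurable
  have "norm (\<integral>y. f (x + y) \<partial>M) \<le> (\<integral>y. norm (f (x + y)) \<partial>M)"
    by simp
  also have "\<dots> \<le> (\<integral>y. c \<partial>M)"
    using int bd by (intro integral_mono) auto
  finally have "norm (\<integral>y. f (x + y) \<partial>M) \<le> c"
    using prob_space by simp
  moreover have "w x * norm (\<integral>y. f (x + y) \<partial>M) \<le> 1 * norm (\<integral>y. f (x + y) \<partial>M)"
    using w01 by (intro mult_right_mono) auto
  ultimately show "norm (walk_step w M f x) \<le> c"
    using w01[of x] by (simp add: walk_step_def)
qed

lemma (in real_distribution) walk_step_funpow_bounded_borel:
  fixes f :: "real \<Rightarrow> 'b::{banach, second_countable_topology}"
  assumes "w \<in> borel_measurable borel" "\<And>x. 0 \<le> w x" "\<And>x. w x \<le> 1"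
    and "f \<in> borel_measurable borel" "\<And>x. norm (f x) \<le> c"
  shows "(walk_step w M ^^ n) f \<in> borel_measurable borel"
    and "norm ((walk_step w M ^^ n) f x) \<le> c"
proof -
  have "(walk_step w M ^^ n) f \<in> borel_measurable borel \<and> (\<forall>x. norm ((walk_step w M ^^ n) f x) \<le> c)"
  proof (induction n)
    case (Suc n)
    thus ?case
      using walk_step_bounded_borel[OF assms(1-3), of "(walk_step w M ^^ n) f" c] by simp
  qed (use assms in simp)
  thus "(walk_step w M ^^ n) f \<in> borel_measurable borel"
    and "norm ((walk_step w M ^^ n) f x) \<le> c" by auto
qed

text \<open>
  A discrete Feynman--Kac formula.  Integrating out the last coordinate replaces \<open>f\<close> by
  \<open>walk_step w M f\<close>, evaluated at the position one step earlier, and the weight at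
  that position is exactly the factor which the product loses.
\<close>

lemma (in real_distribution) integral_PiM_walk:
  fixes f :: "real \<Rightarrow> 'b::{banach, second_countable_topology}"
  assumes w [measurable]: "w \<in> borel_measurable borel" and w01: "\<And>x. 0 \<le> w x" "\<And>x. w x \<le> 1"
    and f: "f \<in> borel_measurable borel" and bd: "\<And>x. norm (f x) \<le> c"
  shows "(\<integral>y. (\<Prod>j<n. w (\<Sum>i<j. y i)) *\<^sub>R f (\<Sum>i<n. y i) \<partial>(\<Pi>\<^sub>M i\<in>{..<n}. M))
    = (walk_step w M ^^ n) f 0"
  using f bd
proof (induction n arbitrary: f)
  case 0
  interpret P: product_prob_space "\<lambda>_::nat. M" "{}" ..
  show ?case by (simp add: P.P.prob_space)
next
  case (Suc n)
  note [measurable] = Suc.prems(1)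
  interpret P: product_sigma_finite "\<lambda>_::nat. M" ..
  interpret PS: product_prob_space "\<lambda>_::nat. M" "{..<Suc n}" ..
  let ?g = "\<lambda>y. (\<Prod>j<Suc n. w (\<Sum>i<j. y i)) *\<^sub>R f (\<Sum>i<Suc n. y i)"
  have comp: "(\<lambda>y. y i) \<in> borel_measurable (\<Pi>\<^sub>M i\<in>{..<Suc n}. M)" if "i < Suc n" for i
    using measurable_component_singleton[of i "{..<Suc n}" "\<lambda>_. M"] that by simp
  have wsum: "(\<lambda>y. w (\<Sum>i<j. y i)) \<in> borel_measurable (\<Pi>\<^sub>M i\<in>{..<Suc n}. M)" if "j < Suc n" for j
    using that by (intro measurable_compose[OF _ w] borel_measurable_sum comp) auto
  have "?g \<in> borel_measurable (\<Pi>\<^sub>M i\<in>{..<Suc n}. M)"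
    by (intro borel_measurable_scaleR borel_measurable_prod measurable_compose[OF _ Suc.prems(1)]
        borel_measurable_sum comp wsum) auto
  moreover have "norm (?g y) \<le> 1 * c" for y
  proof -
    have "0 \<le> (\<Prod>j<Suc n. w (\<Sum>i<j. y i))" "(\<Prod>j<Suc n. w (\<Sum>i<j. y i)) \<le> 1"
      using w01 by (intro prod_nonneg prod_le_1; simp)+
    thus ?thesis
      unfolding norm_scaleR by (intro mult_mono Suc.prems(2)) auto
  qed
  ultimately have int: "integrable (\<Pi>\<^sub>M i\<in>{..<Suc n}. M) ?g"
    by (intro PS.P.integrable_const_bound[where B = c]) auto
  have "(\<integral>y. ?g y \<partial>(\<Pi>\<^sub>M i\<in>{..<Suc n}. M))
      = (\<integral>y. (\<integral>u. ?g (y(n := u)) \<partial>M) \<partial>(\<Pi>\<^sub>M i\<in>{..<n}. M))"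
    using P.product_integral_insert[of "{..<n}" n ?g] int by (simp add: lessThan_Suc)
  also have "\<dots> = (\<integral>y. (\<Prod>j<n. w (\<Sum>i<j. y i)) *\<^sub>R walk_step w M f (\<Sum>i<n. y i)
      \<partial>(\<Pi>\<^sub>M i\<in>{..<n}. M))"
  proof (intro Bochner_Integration.integral_cong refl)
    fix y :: "nat \<Rightarrow> real"
    have "(\<Prod>j<n. w (\<Sum>i<j. (y(n := u)) i)) = (\<Prod>j<n. w (\<Sum>i<j. y i))" for u
      by (intro prod.cong refl arg_cong[where f = w] sum.cong) auto
    moreover have "(\<Sum>i<n. (y(n := u)) i) = (\<Sum>i<n. y i)" for u
      by (intro sum.cong) auto
    ultimately have "?g (y(n := u))
        = ((\<Prod>j<n. w (\<Sum>i<j. y i)) * w (\<Sum>i<n. y i)) *\<^sub>R f ((\<Sum>i<n. y i) + u)" for u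
      by (simp add: add.commute)
    thus "(\<integral>u. ?g (y(n := u)) \<partial>M)
        = (\<Prod>j<n. w (\<Sum>i<j. y i)) *\<^sub>R walk_step w M f (\<Sum>i<n. y i)"
      by (simp add: walk_step_def)
  qed
  also have "\<dots> = (walk_step w M ^^ n) (walk_step w M f) 0"
    using walk_step_bounded_borel[OF w w01 Suc.prems] by (intro Suc.IH)
  also have "\<dots> = (walk_step w M ^^ Suc n) f 0"
    by (simp add: funpow_swap1)
  finally show ?case .
qed

locale random_walk = prob_space M + step: real_distribution N
  for M :: "'a measure" and N :: "real measure" +
  fixes D :: "nat \<Rightarrow> 'a \<Rightarrow> real"
  assumes indep_increments: "\<And>n. indep_vars (\<lambda>_. borel) D {..<n}"
    and distr_increment: "\<And>i. distr M borel (D i) = N"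
begin

lemma increment_measurable [measurable]: "D i \<in> borel_measurable M"
  using indep_increments[of "Suc i"] by (auto simp: indep_vars_def)

lemma expectation_walk:
  fixes f :: "real \<Rightarrow> 'b::{banach, second_countable_topology}"
  assumes w [measurable]: "w \<in> borel_measurable borel" and w01: "\<And>x. 0 \<le> w x" "\<And>x. w x \<le> 1"
    and f [measurable]: "f \<in> borel_measurable borel" and bd: "\<And>x. norm (f x) \<le> c"
  shows "(\<integral>\<omega>. (\<Prod>j<n. w (\<Sum>i<j. D i \<omega>)) *\<^sub>R f (\<Sum>i<n. D i \<omega>) \<partial>M) = (walk_step w N ^^ n) f 0"
proof (cases "n = 0")
  case True
  thus ?thesis by (simp add: prob_space)
next
  case False
  let ?P = "\<Pi>\<^sub>M i\<in>{..<n}. N"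
  let ?g = "\<lambda>y. (\<Prod>j<n. w (\<Sum>i<j. y i)) *\<^sub>R f (\<Sum>i<n. y i)"
  have comp: "(\<lambda>y. y i) \<in> borel_measurable ?P" if "i < n" for i
    using measurable_component_singleton[of i "{..<n}" "\<lambda>_. N"] that by simp
  have wsum: "(\<lambda>y. w (\<Sum>i<j. y i)) \<in> borel_measurable ?P" if "j < n" for j
    using that by (intro measurable_compose[OF _ w] borel_measurable_sum comp) auto
  have g: "?g \<in> borel_measurable ?P"
    by (intro borel_measurable_scaleR borel_measurable_prod measurable_compose[OF _ f]
        borel_measurable_sum comp wsum) auto
  have sets_eq: "sets (\<Pi>\<^sub>M i\<in>{..<n}. borel :: real measure) = sets ?P"
    by (intro sets_PiM_cong) auto
  have law: "distr M (\<Pi>\<^sub>M i\<in>{..<n}. borel) (\<lambda>\<omega>. \<lambda>i\<in>{..<n}. D i \<omega>) = ?P"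
    using indep_vars_iff_distr_eq_PiM[where I = "{..<n}" and M' = "\<lambda>_. borel" and X = D] False indep_increments
    by (auto simp: distr_increment)
  have meas: "(\<lambda>\<omega>. \<lambda>i\<in>{..<n}. D i \<omega>) \<in> measurable M (\<Pi>\<^sub>M i\<in>{..<n}. borel)"
    by measurable
  have "(walk_step w N ^^ n) f 0 = (\<integral>y. ?g y \<partial>?P)"
    by (rule step.integral_PiM_walk[OF w w01 f bd, symmetric])
  also have "\<dots> = (\<integral>\<omega>. ?g (\<lambda>i\<in>{..<n}. D i \<omega>) \<partial>M)"
    using integral_distr[OF meas, of ?g] g by (simp add: law measurable_cong_sets[OF sets_eq refl])
  also have "\<dots> = (\<integral>\<omega>. ?g (\<lambda>i. D i \<omega>) \<partial>M)"
    by (intro Bochner_Integration.integral_cong refl arg_cong2[where f = scaleR] prod.cong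
        arg_cong[where f = w] arg_cong[where f = f] sum.cong) auto
  finally show ?thesis by simp
qed

text \<open>
  If one weighted step in the variable \<open>x\<close> agrees with one unweighted step in the variable \<open>b\<close> up
  to \<open>\<epsilon>\<close>, then \<open>n\<close> steps agree up to \<open>n \<epsilon>\<close>.  The comparison is between \<open>u j\<close>, obtained from
  \<open>\<lambda>x. \<phi> x 0\<close> by \<open>j\<close> weighted steps in \<open>x\<close>, and \<open>v j\<close>, obtained by letting \<open>b\<close> run for \<open>j\<close>
  steps from \<open>0\<close>.  By Fubini, a further weighted step on \<open>v j\<close> can be taken inside the expectation
  over \<open>b\<close>, where it may be exchanged for a step in \<open>b\<close> at cost \<open>\<epsilon>\<close>; the error already present is
  not enlarged, because a weighted step is a contraction for the supremum norm.
\<close>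

lemma duality:
  fixes \<phi> :: "real \<Rightarrow> real \<Rightarrow> 'b::{banach, second_countable_topology}"
  assumes w [measurable]: "w \<in> borel_measurable borel" and w01: "\<And>x. 0 \<le> w x" "\<And>x. w x \<le> 1"
    and \<phi> [measurable]: "case_prod \<phi> \<in> borel_measurable (borel \<Otimes>\<^sub>M borel)"
    and bd: "\<And>x b. norm (\<phi> x b) \<le> c"
    and err: "\<And>x b. norm (walk_step w N (\<lambda>x. \<phi> x b) x - (\<integral>y. \<phi> x (b + y) \<partial>N)) \<le> \<epsilon>"
  shows "norm ((\<integral>\<omega>. (\<Prod>j<n. w (\<Sum>i<j. D i \<omega>)) *\<^sub>R \<phi> (\<Sum>i<n. D i \<omega>) 0 \<partial>M)
      - (\<integral>\<omega>. \<phi> 0 (\<Sum>i<n. D i \<omega>) \<partial>M)) \<le> real n * \<epsilon>"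
proof -
  define S where "S = (\<lambda>n \<omega>. \<Sum>i<n. D i \<omega>)"
  have S [measurable]: "S n \<in> borel_measurable M" for n
    unfolding S_def by measurable
  let ?T = "walk_step w N" and ?P = "walk_step (\<lambda>_. 1 :: real) N"
  define v where "v = (\<lambda>j x. \<integral>\<omega>. \<phi> x (S j \<omega>) \<partial>M)"
  define u where "u = (\<lambda>j. (?T ^^ j) (\<lambda>x. \<phi> x 0))"
  interpret SM: pair_prob_space N M ..
  have v_meas [measurable]: "v j \<in> borel_measurable borel" for j
    unfolding v_def by measurable
  have int\<phi>: "integrable M (\<lambda>\<omega>. \<phi> x (S j \<omega>))" for x j
    by (rule integrable_const_bound[where B = c]) (use bd in auto)
  have v_bd: "norm (v j x) \<le> c" for j x
  proof -
    have "norm (v j x) \<le> (\<integral>\<omega>. norm (\<phi> x (S j \<omega>)) \<partial>M)"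
      unfolding v_def by simp
    also have "\<dots> \<le> (\<integral>\<omega>. c \<partial>M)"
      using int\<phi> bd by (intro integral_mono) auto
    finally show ?thesis by (simp add: prob_space)
  qed
  have u_meas [measurable]: "u j \<in> borel_measurable borel" and u_bd: "norm (u j x) \<le> c" for j x
    unfolding u_def by (rule step.walk_step_funpow_bounded_borel[OF w w01]; use bd in auto)+
  have v_walk: "v j x = (?P ^^ j) (\<phi> x) 0" for j x
    using expectation_walk[of "\<lambda>_. 1" "\<phi> x" c j] bd by (simp add: v_def S_def)
  have v_Suc: "v (Suc j) x = (\<integral>\<omega>. (\<integral>y. \<phi> x (S j \<omega> + y) \<partial>N) \<partial>M)" for j x
  proof -
    have "v (Suc j) x = (?P ^^ j) (?P (\<phi> x)) 0"
      unfolding v_walk by (simp add: funpow_swap1)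
    also have "\<dots> = (\<integral>\<omega>. ?P (\<phi> x) (S j \<omega>) \<partial>M)"
      using expectation_walk[of "\<lambda>_. 1" "?P (\<phi> x)" c j]
        step.walk_step_bounded_borel[of "\<lambda>_. 1" "\<phi> x" c] bd
      by (simp add: S_def)
    finally show ?thesis by (simp add: walk_step_def)
  qed
  have T_v: "?T (v j) x = (\<integral>\<omega>. ?T (\<lambda>x. \<phi> x (S j \<omega>)) x \<partial>M)" for j x
  proof -
    have "integrable (N \<Otimes>\<^sub>M M) (\<lambda>(y, \<omega>). \<phi> (x + y) (S j \<omega>))"
      by (rule SM.P.integrable_const_bound[where B = c]) (use bd in auto)
    from SM.Fubini_integral[OF this] show ?thesis
      by (simp add: walk_step_def v_def)
  qed
  have T_int: "integrable M (\<lambda>\<omega>. ?T (\<lambda>x. \<phi> x (S j \<omega>)) x)" for j x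
  proof (rule integrable_const_bound[where B = c])
    show "AE \<omega> in M. norm (?T (\<lambda>x. \<phi> x (S j \<omega>)) x) \<le> c"
      using step.walk_step_bounded_borel(2)[OF w w01, of "\<lambda>x. \<phi> x b" c for b] bd by auto
    show "(\<lambda>\<omega>. ?T (\<lambda>x. \<phi> x (S j \<omega>)) x) \<in> borel_measurable M"
      unfolding walk_step_def by measurable
  qed
  have P_int: "integrable M (\<lambda>\<omega>. \<integral>y. \<phi> x (S j \<omega> + y) \<partial>N)" for j x
  proof (rule integrable_const_bound[where B = c])
    show "AE \<omega> in M. norm (\<integral>y. \<phi> x (S j \<omega> + y) \<partial>N) \<le> c"
      using step.walk_step_bounded_borel(2)[of "\<lambda>_. 1" "\<phi> x" c] bd
      by (auto simp: walk_step_def)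
  qed measurable
  have local_err: "norm (?T (v j) x - v (Suc j) x) \<le> \<epsilon>" for j x
  proof -
    have "?T (v j) x - v (Suc j) x
        = (\<integral>\<omega>. ?T (\<lambda>x. \<phi> x (S j \<omega>)) x - (\<integral>y. \<phi> x (S j \<omega> + y) \<partial>N) \<partial>M)"
      unfolding T_v v_Suc by (rule Bochner_Integration.integral_diff[OF T_int P_int, symmetric])
    also have "norm \<dots> \<le> (\<integral>\<omega>. norm (?T (\<lambda>x. \<phi> x (S j \<omega>)) x - (\<integral>y. \<phi> x (S j \<omega> + y) \<partial>N)) \<partial>M)"
      by simp
    also have "\<dots> \<le> (\<integral>\<omega>. \<epsilon> \<partial>M)"
      by (intro integral_mono integrable_norm Bochner_Integration.integrable_diff T_int P_int err) auto
    finally show ?thesis by (simp add: prob_space)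
  qed
  have "norm (u j x - v j x) \<le> real j * \<epsilon>" for j x
  proof (induction j arbitrary: x)
    case 0
    show ?case by (simp add: u_def v_def S_def prob_space)
  next
    case (Suc j)
    have iu: "integrable N (\<lambda>y. u j (x + y))" for x
      by (rule step.integrable_bounded_borel[OF _ u_bd]) measurable
    have iv: "integrable N (\<lambda>y. v j (x + y))" for x
      by (rule step.integrable_bounded_borel[OF _ v_bd]) measurable
    have "?T (u j) x - ?T (v j) x = ?T (\<lambda>x. u j x - v j x) x"
      using iu iv by (simp add: walk_step_def scaleR_diff_right)
    moreover have "norm (?T (\<lambda>x. u j x - v j x) x) \<le> real j * \<epsilon>"
      by (rule step.walk_step_bounded_borel[OF w w01 _ Suc.IH]) measurable
    ultimately have "norm (?T (u j) x - ?T (v j) x) \<le> real j * \<epsilon>"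
      by simp
    moreover have "u (Suc j) x - v (Suc j) x
        = (?T (u j) x - ?T (v j) x) + (?T (v j) x - v (Suc j) x)"
      by (simp add: u_def)
    ultimately show ?case
      using local_err[of j x] norm_triangle_ineq[of "?T (u j) x - ?T (v j) x" "?T (v j) x - v (Suc j) x"]
      by (simp add: algebra_simps)
  qed
  from this[of n 0] show ?thesis
    using expectation_walk[OF w w01, of "\<lambda>x. \<phi> x 0" c n] bd
    by (simp add: u_def v_def S_def)
qed

end

section \<open>Gaussian averages of exponentials\<close>

abbreviation gauss :: "real \<Rightarrow> real \<Rightarrow> real measure" where
  "gauss \<mu> \<sigma> \<equiv> density lborel (\<lambda>x. ennreal (normal_density \<mu> \<sigma> x))"

lemma real_distribution_gauss: "\<sigma> > 0 \<Longrightarrow> real_distribution (gauss \<mu> \<sigma>)"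
  by (simp add: real_distribution_def real_distribution_axioms_def prob_space_normal_density)

text \<open>
  The source of the uniform constants below: polynomial growth in \<open>x\<close> is absorbed by
  \<open>exp (- \<kappa> x)\<close> with a constant that depends on \<open>\<kappa>\<close> and the degree only.
\<close>

lemma power_times_exp_le:
  fixes x \<kappa> :: real
  assumes "x \<ge> 0" "\<kappa> > 0"
  shows "x ^ n * exp (- (\<kappa> * x)) \<le> fact n / \<kappa> ^ n"
proof -
  have "(\<Sum>i\<in>{n}. (\<kappa> * x) ^ i /\<^sub>R fact i) \<le> (\<Sum>i. (\<kappa> * x) ^ i /\<^sub>R fact i)"
    by (rule sum_le_suminf[OF summable_exp_generic]) (use assms in auto)
  hence "(\<kappa> * x) ^ n / fact n \<le> exp (\<kappa> * x)"
    by (simp add: exp_def divide_inverse mult.commute)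
  thus ?thesis
    using assms by (simp add: exp_minus field_simps)
qed

text \<open>
  Both \<open>\<phi>\<close> as a function of \<open>x\<close> and \<open>\<phi>\<close> as a function of \<open>b\<close> have the form \<open>exp (- z)\<close> where
  \<open>z\<close> and its derivative \<open>\<zeta>\<close> satisfy \<open>\<zeta>' = z\<close>, and where \<open>Re z\<close> controls \<open>\<bar>z\<bar>\<close> and \<open>\<bar>\<zeta>\<bar>\<close> along the
  real axis.  The bounding function \<open>R\<close> may be unbounded; only the ratio \<open>\<kappa>\<close> enters the
  estimates, so they hold uniformly in the parameters that are suppressed in \<open>z\<close>.
\<close>

context
  fixes z \<zeta> :: "complex \<Rightarrow> complex" and R :: "real \<Rightarrow> real" and \<kappa> :: real
  assumes z_deriv: "\<And>w. (z has_field_derivative \<zeta> w) (at w)"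
    and \<zeta>_deriv: "\<And>w. (\<zeta> has_field_derivative z w) (at w)"
    and z_bound: "\<And>y. norm (z (of_real y)) \<le> R y"
    and \<zeta>_bound: "\<And>y. norm (\<zeta> (of_real y)) \<le> R y"
    and Re_z: "\<And>y. \<kappa> * R y \<le> Re (z (of_real y))"
    and \<kappa>: "\<kappa> > 0"
begin

text \<open>
  The third derivative of \<open>exp (- z)\<close> is \<open>(3 z \<zeta> - \<zeta> - \<zeta>\<^sup>3) exp (- z)\<close>.  It is bounded on the real
  axis by \<open>(3 R\<^sup>2 + R + R\<^sup>3) exp (- \<kappa> R)\<close>, hence by a constant.
\<close>

lemma exp_neg_Taylor:
  fixes y :: real
  shows "norm (exp (- z (of_real y)) - (exp (- z 0) - \<zeta> 0 * exp (- z 0) * of_real y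
      + ((\<zeta> 0)\<^sup>2 - z 0) * exp (- z 0) * of_real (y\<^sup>2 / 2)))
    \<le> (6 / \<kappa>^2 + 1 / \<kappa> + 6 / \<kappa>^3) / 2 * \<bar>y\<bar> ^ 3"
proof -
  define C where "C = 6 / \<kappa>^2 + 1 / \<kappa> + 6 / \<kappa>^3"
  \<comment> \<open>The successive derivatives of \<open>exp (- z)\<close>, as factors of \<open>exp (- z)\<close>.\<close>
  define f :: "nat \<Rightarrow> complex \<Rightarrow> complex" where
    "f = (\<lambda>i w. [1, - \<zeta> w, (\<zeta> w)\<^sup>2 - z w, 3 * z w * \<zeta> w - \<zeta> w - \<zeta> w ^ 3] ! i * exp (- z w))"
  have "((\<lambda>w. exp (- z w)) has_field_derivative - \<zeta> w * exp (- z w)) (at w)" for w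
    by (rule DERIV_cong, (rule derivative_intros z_deriv)+) simp
  moreover have "((\<lambda>w. - \<zeta> w * exp (- z w)) has_field_derivative
      ((\<zeta> w)\<^sup>2 - z w) * exp (- z w)) (at w)" for w
    by (rule DERIV_cong, (rule derivative_intros z_deriv \<zeta>_deriv)+)
      (simp add: algebra_simps power2_eq_square)
  moreover have "((\<lambda>w. ((\<zeta> w)\<^sup>2 - z w) * exp (- z w)) has_field_derivative
      (3 * z w * \<zeta> w - \<zeta> w - \<zeta> w ^ 3) * exp (- z w)) (at w)" for w
    by (rule DERIV_cong, (rule derivative_intros z_deriv \<zeta>_deriv)+)
      (simp add: algebra_simps power2_eq_square power3_eq_cube)
  note f_derivs = calculation this
  have deriv: "(f i has_field_derivative f (Suc i) w) (at w within \<real>)"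
    if "i \<le> 2" for i w
  proof -
    have "i = 0 \<or> i = 1 \<or> i = 2"
      using that by linarith
    thus ?thesis
      using f_derivs
      by (elim disjE) (simp_all add: f_def eval_nat_numeral has_field_derivative_at_within)
  qed
  have bound: "norm (f (Suc 2) w) \<le> C" if real: "w \<in> \<real>" for w
  proof -
    obtain y where w: "w = of_real y" using real by (auto elim: Reals_cases)
    have R0: "R y \<ge> 0" using z_bound[of y] norm_ge_zero order_trans by blast
    have "norm (3 * z w * \<zeta> w - \<zeta> w - \<zeta> w ^ 3) \<le> norm (3 * z w * \<zeta> w) + norm (\<zeta> w) + norm (\<zeta> w ^ 3)"
      by (meson add_mono norm_triangle_ineq4 order_refl order_trans)
    also have "\<dots> = 3 * (norm (z w) * norm (\<zeta> w)) + norm (\<zeta> w) + norm (\<zeta> w) ^ 3"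
      by (simp add: norm_mult norm_power)
    also have "\<dots> \<le> 3 * (R y * R y) + R y + R y ^ 3"
      unfolding w by (intro add_mono mult_mono power_mono z_bound \<zeta>_bound R0) auto
    finally have 1: "norm (3 * z w * \<zeta> w - \<zeta> w - \<zeta> w ^ 3) \<le> 3 * R y ^ 2 + R y ^ 1 + R y ^ 3"
      by (simp add: power2_eq_square)
    have 2: "norm (exp (- z w)) \<le> exp (- (\<kappa> * R y))"
      using Re_z[of y] by (simp add: w)
    have "norm (f (Suc 2) w) = norm (3 * z w * \<zeta> w - \<zeta> w - \<zeta> w ^ 3) * norm (exp (- z w))"
      by (simp add: f_def norm_mult)
    also have "\<dots> \<le> (3 * R y ^ 2 + R y ^ 1 + R y ^ 3) * exp (- (\<kappa> * R y))"
      using R0 by (intro mult_mono 1 2) auto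
    also have "\<dots> = 3 * (R y ^ 2 * exp (- (\<kappa> * R y))) + R y ^ 1 * exp (- (\<kappa> * R y))
        + R y ^ 3 * exp (- (\<kappa> * R y))"
      by (simp add: algebra_simps)
    also have "\<dots> \<le> 3 * (fact 2 / \<kappa>^2) + fact 1 / \<kappa>^1 + fact 3 / \<kappa>^3"
      by (intro add_mono mult_left_mono power_times_exp_le R0 \<kappa>) auto
    finally show ?thesis by (simp add: C_def fact_numeral)
  qed
  have "norm (f 0 (of_real y) - (\<Sum>i\<le>2. f i 0 * (of_real y - 0) ^ i / fact i))
      \<le> C * norm (complex_of_real y - 0) ^ Suc 2 / fact 2"
    by (rule field_Taylor[of \<real>]) (use deriv bound convex_Reals in auto)
  moreover have "(\<Sum>i\<le>2. f i 0 * (of_real y - 0) ^ i / fact i)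
      = exp (- z 0) - \<zeta> 0 * exp (- z 0) * of_real y
        + ((\<zeta> 0)\<^sup>2 - z 0) * exp (- z 0) * of_real (y\<^sup>2 / 2)"
    by (simp add: f_def eval_nat_numeral)
  moreover have "C * norm (complex_of_real y - 0) ^ Suc 2 / fact 2 = C / 2 * \<bar>y\<bar> ^ 3"
    by (simp add: eval_nat_numeral)
  moreover have "f 0 (of_real y) = exp (- z (of_real y))"
    by (simp add: f_def)
  ultimately show ?thesis
    by (simp only: C_def)
qed

text \<open>
  Averaging the Taylor polynomial over a centred Gaussian of variance \<open>h\<close> leaves the value plus
  \<open>h / 2\<close> times the second derivative; the remainder is a third absolute moment, of order
  \<open>h powr (3/2)\<close>.
\<close>

lemma exp_neg_gauss:
  assumes h: "h > 0"
  shows "norm ((\<integral>y. exp (- z (of_real y)) \<partial>gauss 0 (sqrt h))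
      - exp (- z 0) * (1 + of_real (h / 2) * ((\<zeta> 0)\<^sup>2 - z 0)))
    \<le> (6 / \<kappa>^2 + 1 / \<kappa> + 6 / \<kappa>^3) * (h * sqrt h)"
proof -
  define C where "C = 6 / \<kappa>^2 + 1 / \<kappa> + 6 / \<kappa>^3"
  define N where "N = gauss 0 (sqrt h)"
  define c1 where "c1 = - \<zeta> 0 * exp (- z 0)"
  define c2 where "c2 = ((\<zeta> 0)\<^sup>2 - z 0) * exp (- z 0)"
  interpret N: real_distribution N
    unfolding N_def using h by (intro real_distribution_gauss) simp
  have h': "sqrt h > 0" using h by simp
  have C0: "C \<ge> 0" using \<kappa> by (simp add: C_def)
  have i1: "has_bochner_integral N (\<lambda>y. y) 0"
    using normal_moment_odd[OF h', of 0 0] by (simp add: N_def has_bochner_integral_density)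
  have i2: "has_bochner_integral N (\<lambda>y. y\<^sup>2) h"
    using normal_moment_even[OF h', of 0 1] h by (simp add: N_def has_bochner_integral_density)
  have i3: "has_bochner_integral N (\<lambda>y. \<bar>y\<bar> ^ 3) (2 * sqrt h ^ 3 * sqrt (2 / pi))"
    using normal_moment_abs_odd[OF h', of 0 1] by (simp add: N_def has_bochner_integral_density)
  have cont: "continuous_on UNIV (\<lambda>y. z (complex_of_real y))"
  proof -
    have "continuous_on UNIV z"
      by (rule DERIV_continuous_on) (use z_deriv in auto)
    thus ?thesis by (auto intro!: continuous_on_compose2[of UNIV z] continuous_intros)
  qed
  have [measurable]: "(\<lambda>y. z (complex_of_real y)) \<in> borel_measurable borel"
    using cont by (rule borel_measurable_continuous_onI)
  have Re0: "Re (z (of_real y)) \<ge> 0" for y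
  proof -
    have "0 \<le> R y" using z_bound[of y] norm_ge_zero order_trans by blast
    thus ?thesis using Re_z[of y] \<kappa> by (meson mult_nonneg_nonneg order_trans less_imp_le)
  qed
  have ie: "integrable N (\<lambda>y. exp (- z (of_real y)))"
    by (rule N.integrable_bounded_borel[where c = 1]) (use Re0 in auto)
  have ic1: "has_bochner_integral N (\<lambda>y. c1 * of_real y) (c1 * of_real 0)"
    by (intro has_bochner_integral_mult_right has_bochner_integral_of_real i1)
  have ic2: "has_bochner_integral N (\<lambda>y. c2 * of_real (y\<^sup>2 / 2)) (c2 * of_real (h / 2))"
    by (intro has_bochner_integral_mult_right has_bochner_integral_of_real
        has_bochner_integral_divide_zero i2)
  have ic0: "has_bochner_integral N (\<lambda>y. exp (- z 0)) (exp (- z 0))"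
    using N.prob_space by (simp add: has_bochner_integral_iff)
  have ip: "has_bochner_integral N (\<lambda>y. exp (- z 0) + c1 * of_real y + c2 * of_real (y\<^sup>2 / 2))
      (exp (- z 0) + c1 * of_real 0 + c2 * of_real (h / 2))"
    by (intro has_bochner_integral_add ic0 ic1 ic2)
  let ?p = "\<lambda>y. exp (- z 0) + c1 * of_real y + c2 * of_real (y\<^sup>2 / 2)"
  have "(\<integral>y. exp (- z (of_real y)) \<partial>N) - exp (- z 0) * (1 + of_real (h / 2) * ((\<zeta> 0)\<^sup>2 - z 0))
      = (\<integral>y. exp (- z (of_real y)) \<partial>N) - (\<integral>y. ?p y \<partial>N)"
    using has_bochner_integral_integral_eq[OF ip] by (simp add: c2_def algebra_simps)
  also have "\<dots> = (\<integral>y. exp (- z (of_real y)) - ?p y \<partial>N)"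
    using ie ip
    by (intro Bochner_Integration.integral_diff[symmetric]) (auto simp: has_bochner_integral_iff)
  also have "norm \<dots> \<le> (\<integral>y. norm (exp (- z (of_real y)) - ?p y) \<partial>N)"
    by simp
  also have "\<dots> \<le> (\<integral>y. C / 2 * \<bar>y\<bar> ^ 3 \<partial>N)"
  proof (rule integral_mono)
    show "integrable N (\<lambda>y. norm (exp (- z (of_real y)) - ?p y))"
      using ie ip by (intro integrable_norm Bochner_Integration.integrable_diff)
        (auto simp: has_bochner_integral_iff)
    show "integrable N (\<lambda>y. C / 2 * \<bar>y\<bar> ^ 3)"
      using i3 by (intro integrable_mult_right) (auto simp: has_bochner_integral_iff)
    show "norm (exp (- z (of_real y)) - ?p y) \<le> C / 2 * \<bar>y\<bar> ^ 3" for y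
      using exp_neg_Taylor[of y] by (simp add: c1_def c2_def C_def)
  qed
  also have "\<dots> = C / 2 * (2 * sqrt h ^ 3 * sqrt (2 / pi))"
    using has_bochner_integral_integral_eq[OF has_bochner_integral_mult_right[OF i3, of "C / 2"]]
    by simp
  also have "\<dots> = C * (h * sqrt h) * sqrt (2 / pi)"
    using h by (simp add: power3_eq_cube)
  also have "\<dots> \<le> C * (h * sqrt h) * 1"
    using C0 h pi_gt3 by (intro mult_left_mono) (auto simp: field_simps)
  finally show ?thesis by (simp add: C_def N_def)
qed

end

lemma exp_neg_remainder:
  fixes a :: real
  assumes "a \<ge> 0"
  shows "\<bar>exp (- a) - 1\<bar> \<le> a" and "\<bar>exp (- a) - 1 + a\<bar> \<le> a\<^sup>2"
proof -
  have lower: "1 - a \<le> exp (- a)"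
    using exp_ge_add_one_self[of "- a"] by simp
  thus "\<bar>exp (- a) - 1\<bar> \<le> a"
    using assms by (simp add: abs_if)
  have "exp (- a) \<le> 1 / (1 + a)"
    using exp_ge_add_one_self[of a] assms by (simp add: exp_minus field_simps)
  also have "\<dots> \<le> 1 - a + a\<^sup>2"
    using assms by (simp add: field_simps power2_eq_square)
  finally show "\<bar>exp (- a) - 1 + a\<bar> \<le> a\<^sup>2"
    using lower by simp
qed

section \<open>Exchanging killing in one variable for diffusion in the other\<close>

lemma cosh_complex_of_real: "cosh (complex_of_real x) = complex_of_real (cosh x)"
  by (simp add: cosh_field_def exp_of_real flip: of_real_minus)

lemma sinh_complex_of_real: "sinh (complex_of_real x) = complex_of_real (sinh x)"
  by (simp add: sinh_field_def exp_of_real flip: of_real_minus)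

lemma abs_sinh_le_cosh: "\<bar>sinh x\<bar> \<le> cosh (x::real)"
  by (simp add: sinh_field_def cosh_field_def abs_le_iff)

text \<open>
  For \<open>s\<^sup>2 = g\<^sup>2 - l\<^sup>2\<close> this function \<open>\<phi>\<close> solves \<open>1/2 \<phi>\<^sub>x\<^sub>x - l\<^sup>2 / 2 exp (2 x) \<phi> = 1/2 \<phi>\<^sub>b\<^sub>b\<close>.  The parameter \<open>s\<close> is
  complex so as to cover \<open>g < l\<close>, where \<open>s\<close> is imaginary.
\<close>

definition swap_kernel :: "real \<Rightarrow> complex \<Rightarrow> real \<Rightarrow> real \<Rightarrow> complex" where
  "swap_kernel g s x b
     = exp (- (complex_of_real (exp x) * (of_real (g * cosh b) + s * of_real (sinh b))))"

lemma swap_kernel_measurable [measurable]: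
  "case_prod (swap_kernel g s) \<in> borel_measurable (borel \<Otimes>\<^sub>M borel)"
proof -
  have "continuous_on UNIV (case_prod (swap_kernel g s))"
    unfolding swap_kernel_def case_prod_unfold by (intro continuous_intros)
  thus ?thesis
    by (subst borel_prod) (rule borel_measurable_continuous_onI)
qed

lemma swap_kernel_zero: "swap_kernel g s x 0 = complex_of_real (exp (- (g * exp x)))"
proof -
  have "- (complex_of_real (exp x) * (of_real (g * cosh 0) + s * of_real (sinh 0)))
      = complex_of_real (- (g * exp x))"
    by (simp add: mult.commute)
  thus ?thesis
    by (simp only: swap_kernel_def exp_of_real)
qed

lemma Re_hyperbolic_ge:
  fixes s :: complex
  shows "(g - \<bar>Re s\<bar>) * cosh b \<le> Re (of_real (g * cosh b) + s * of_real (sinh b))"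
proof -
  have "\<bar>Re s * sinh b\<bar> \<le> \<bar>Re s\<bar> * cosh b"
    unfolding abs_mult by (intro mult_left_mono abs_sinh_le_cosh) simp
  thus ?thesis by (simp add: algebra_simps abs_le_iff)
qed

lemma norm_swap_kernel_le:
  assumes "\<bar>Re s\<bar> < g"
  shows "norm (swap_kernel g s x b) \<le> 1"
proof -
  have "0 \<le> (g - \<bar>Re s\<bar>) * cosh b"
    using assms by simp
  hence "0 \<le> Re (of_real (g * cosh b) + s * of_real (sinh b))"
    using Re_hyperbolic_ge order_trans by blast
  hence "0 \<le> exp x * Re (of_real (g * cosh b) + s * of_real (sinh b))"
    by (rule mult_nonneg_nonneg[OF exp_ge_zero])
  thus ?thesis by (simp add: swap_kernel_def)
qed

text \<open>
  With \<open>Z = exp x (g cosh b + s sinh b)\<close> and \<open>Z' = exp x (g sinh b + s cosh b)\<close>, the second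
  derivatives of the kernel in \<open>x\<close> and in \<open>b\<close> are \<open>(Z\<^sup>2 - Z) exp (- Z)\<close> and
  \<open>(Z'\<^sup>2 - Z) exp (- Z)\<close>.  Their difference is \<open>(Z\<^sup>2 - Z'\<^sup>2) exp (- Z) = l\<^sup>2 exp (2 x) exp (- Z)\<close>, by
  the hyperbolic Pythagoras identity, and this is what the weight removes to first order in \<open>h\<close>.
  The condition on \<open>Re s\<close> makes \<open>Re Z\<close> comparable to \<open>exp x cosh b\<close>, which also dominates
  \<open>\<bar>Z\<bar>\<close>, \<open>\<bar>Z'\<bar>\<close> and the killing rate; hence the error is uniform in \<open>x\<close> and \<open>b\<close>.
\<close>

lemma swap_kernel_one_step:
  fixes g l :: real and s :: complex
  assumes s: "s\<^sup>2 = of_real (g\<^sup>2 - l\<^sup>2)" "\<bar>Re s\<bar> < g"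
  shows "\<exists>C1 C2. \<forall>h>0. \<forall>x b.
    norm (walk_step (\<lambda>x. exp (- (l\<^sup>2 / 2 * h * exp (2 * x)))) (gauss 0 (sqrt h))
        (\<lambda>x. swap_kernel g s x b) x
      - (\<integral>y. swap_kernel g s x (b + y) \<partial>gauss 0 (sqrt h))) \<le> C1 * h\<^sup>2 + C2 * (h * sqrt h)"
proof -
  define K where "K = g + norm s"
  \<comment> \<open>\<open>K exp x cosh b\<close> bounds \<open>\<bar>Z\<bar>\<close> and \<open>\<bar>Z'\<bar>\<close> from above, and \<open>\<kappa>\<close> times it bounds \<open>Re Z\<close> from below.\<close>
  define \<kappa> where "\<kappa> = (g - \<bar>Re s\<bar>) / K"
  define C where "C = 6 / \<kappa>^2 + 1 / \<kappa> + 6 / \<kappa>^3"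
  have K: "K > 0" and g0: "g > 0"
    using s(2) by (simp_all add: K_def add_pos_nonneg)
  have \<kappa>: "\<kappa> > 0"
    using s(2) K by (simp add: \<kappa>_def)
  have \<kappa>K: "\<kappa> * K = g - \<bar>Re s\<bar>"
    using K by (simp add: \<kappa>_def)
  have lK: "l\<^sup>2 \<le> K\<^sup>2"
  proof -
    have "complex_of_real (l\<^sup>2) = of_real (g\<^sup>2) - s\<^sup>2"
      using s(1) by simp
    hence "l\<^sup>2 = norm (of_real (g\<^sup>2) - s\<^sup>2)"
      by (metis norm_of_real abs_power2)
    also have "\<dots> \<le> g\<^sup>2 + (norm s)\<^sup>2"
      by (rule order_trans[OF norm_triangle_ineq4]) (simp add: norm_power)
    also have "\<dots> \<le> K\<^sup>2"
      using g0 by (simp add: K_def power2_sum)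
    finally show ?thesis .
  qed
  have step: "norm (walk_step (\<lambda>x. exp (- (l\<^sup>2 / 2 * h * exp (2 * x)))) (gauss 0 (sqrt h))
        (\<lambda>x. swap_kernel g s x b) x
      - (\<integral>y. swap_kernel g s x (b + y) \<partial>gauss 0 (sqrt h)))
      \<le> (12 / \<kappa>^4 + 3 / (2 * \<kappa>^3)) * h\<^sup>2 + (2 * C) * (h * sqrt h)"
    if h: "h > 0" for h x b
  proof -
    define c where "c = (\<lambda>b. of_real g * cosh b + s * sinh b)"
    define c' where "c' = (\<lambda>b. of_real g * sinh b + s * cosh b)"
    define E where "E = complex_of_real (exp x)"
    define Z where "Z = E * c (of_real b)"
    define Z' where "Z' = E * c' (of_real b)"
    define a where "a = l\<^sup>2 / 2 * h * exp (2 * x)"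
    define R where "R = exp x * (K * cosh b)"
    define I1 where "I1 = (\<integral>y. swap_kernel g s (x + y) b \<partial>gauss 0 (sqrt h))"
    define I2 where "I2 = (\<integral>y. swap_kernel g s x (b + y) \<partial>gauss 0 (sqrt h))"
    have kernel: "swap_kernel g s u v = exp (- (of_real (exp u) * c (of_real v)))" for u v
      by (simp add: swap_kernel_def c_def cosh_complex_of_real sinh_complex_of_real)
    have c_bound: "norm (c (of_real v)) \<le> K * cosh v" and c'_bound: "norm (c' (of_real v)) \<le> K * cosh v"
      and Re_c: "\<kappa> * (K * cosh v) \<le> Re (c (of_real v))" for v
    proof -
      have "norm (c (of_real v)) \<le> g * cosh v + norm s * \<bar>sinh v\<bar>"
        unfolding c_def by (rule order_trans[OF norm_triangle_ineq])
          (use g0 in \<open>simp add: norm_mult cosh_complex_of_real sinh_complex_of_real\<close>)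
      also have "\<dots> \<le> g * cosh v + norm s * cosh v"
        by (intro add_left_mono mult_left_mono abs_sinh_le_cosh) simp
      finally show "norm (c (of_real v)) \<le> K * cosh v"
        by (simp add: K_def algebra_simps)
      have "norm (c' (of_real v)) \<le> g * \<bar>sinh v\<bar> + norm s * cosh v"
        unfolding c'_def by (rule order_trans[OF norm_triangle_ineq])
          (use g0 in \<open>simp add: norm_mult cosh_complex_of_real sinh_complex_of_real\<close>)
      also have "\<dots> \<le> g * cosh v + norm s * cosh v"
        using g0 by (intro add_right_mono mult_left_mono abs_sinh_le_cosh) simp
      finally show "norm (c' (of_real v)) \<le> K * cosh v"
        by (simp add: K_def algebra_simps)
      show "\<kappa> * (K * cosh v) \<le> Re (c (of_real v))"
        using Re_hyperbolic_ge[of g s v] \<kappa>K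
        by (simp add: c_def cosh_complex_of_real sinh_complex_of_real mult.assoc[symmetric])
    qed
    have Z: "norm Z \<le> R" "norm Z' \<le> R" "\<kappa> * R \<le> Re Z"
      using c_bound[of b] c'_bound[of b] mult_left_mono[OF Re_c[of b] exp_ge_zero[of x]]
      by (simp_all add: Z_def Z'_def E_def R_def norm_mult mult.left_commute)
    have R0: "R \<ge> 0"
      using Z(1) norm_ge_zero order_trans by blast
    have d1: "norm (I1 - exp (- Z) * (1 + of_real (h / 2) * (Z\<^sup>2 - Z))) \<le> C * (h * sqrt h)"
    proof -
      \<comment> \<open>In the variable \<open>x\<close> the function \<open>z\<close> is its own derivative, so \<open>\<zeta> = z\<close>.\<close>
      let ?z = "\<lambda>w. E * exp w * c (of_real b)"
      have "norm ((\<integral>y. exp (- ?z (of_real y)) \<partial>gauss 0 (sqrt h))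
          - exp (- ?z 0) * (1 + of_real (h / 2) * ((?z 0)\<^sup>2 - ?z 0))) \<le> C * (h * sqrt h)"
        unfolding C_def
      proof (rule exp_neg_gauss[where R = "\<lambda>y. exp (x + y) * (K * cosh b)", OF _ _ _ _ _ \<kappa> h])
        show "(?z has_field_derivative ?z w) (at w)" for w
          by (auto intro!: derivative_eq_intros)
        thus "(?z has_field_derivative ?z w) (at w)" for w .
        show "norm (?z (of_real y)) \<le> exp (x + y) * (K * cosh b)" for y
          using c_bound[of b] by (simp add: E_def norm_mult exp_add exp_of_real mult.assoc)
        thus "norm (?z (of_real y)) \<le> exp (x + y) * (K * cosh b)" for y .
        show "\<kappa> * (exp (x + y) * (K * cosh b)) \<le> Re (?z (of_real y))" for y
          using mult_left_mono[OF Re_c[of b] exp_ge_zero[of "x + y"]]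
          by (simp add: E_def exp_add exp_of_real mult.left_commute mult.assoc flip: of_real_mult)
      qed
      thus ?thesis
        by (simp add: I1_def kernel Z_def E_def exp_add exp_of_real)
    qed
    have d2: "norm (I2 - exp (- Z) * (1 + of_real (h / 2) * (Z'\<^sup>2 - Z))) \<le> C * (h * sqrt h)"
    proof -
      let ?z = "\<lambda>w. E * c (of_real b + w)" and ?z' = "\<lambda>w. E * c' (of_real b + w)"
      have "norm ((\<integral>y. exp (- ?z (of_real y)) \<partial>gauss 0 (sqrt h))
          - exp (- ?z 0) * (1 + of_real (h / 2) * ((?z' 0)\<^sup>2 - ?z 0))) \<le> C * (h * sqrt h)"
        unfolding C_def
      proof (rule exp_neg_gauss[where R = "\<lambda>y. exp x * (K * cosh (b + y))", OF _ _ _ _ _ \<kappa> h])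
        show "(?z has_field_derivative ?z' w) (at w)" for w
          unfolding c_def c'_def by (auto intro!: derivative_eq_intros)
        show "(?z' has_field_derivative ?z w) (at w)" for w
          unfolding c_def c'_def by (auto intro!: derivative_eq_intros)
        show "norm (?z (of_real y)) \<le> exp x * (K * cosh (b + y))" for y
          using c_bound[of "b + y"] by (simp add: E_def norm_mult)
        show "norm (?z' (of_real y)) \<le> exp x * (K * cosh (b + y))" for y
          using c'_bound[of "b + y"] by (simp add: E_def norm_mult)
        show "\<kappa> * (exp x * (K * cosh (b + y))) \<le> Re (?z (of_real y))" for y
          using mult_left_mono[OF Re_c[of "b + y"] exp_ge_zero[of x]]
          by (simp add: E_def mult.left_commute)
      qed
      thus ?thesis
        by (simp add: I2_def kernel Z_def Z'_def E_def)
    qed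
    have pyth: "Z\<^sup>2 - Z'\<^sup>2 = of_real (l\<^sup>2 * exp (2 * x))"
    proof -
      have "Z\<^sup>2 - Z'\<^sup>2 = E\<^sup>2 * ((of_real g)\<^sup>2 - s\<^sup>2) * ((cosh (of_real b))\<^sup>2 - (sinh (of_real b))\<^sup>2)"
        by (simp add: Z_def Z'_def c_def c'_def algebra_simps power2_eq_square)
      also have "\<dots> = E\<^sup>2 * of_real (l\<^sup>2)"
        using s(1) by (simp add: hyperbolic_pythagoras)
      also have "E\<^sup>2 = of_real (exp (2 * x))"
        by (simp add: E_def exp_double)
      finally show ?thesis
        by (simp add: mult.commute)
    qed
    have a0: "a \<ge> 0"
      using h by (simp add: a_def)
    have a_le: "a \<le> h / 2 * R\<^sup>2"
    proof -
      have "l\<^sup>2 * (exp x)\<^sup>2 * 1 \<le> K\<^sup>2 * (exp x)\<^sup>2 * (cosh b)\<^sup>2"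
        using lK cosh_real_ge_1[of b] by (intro mult_mono) (auto intro: one_le_power)
      hence "h / 2 * (l\<^sup>2 * (exp x)\<^sup>2 * 1) \<le> h / 2 * (K\<^sup>2 * (exp x)\<^sup>2 * (cosh b)\<^sup>2)"
        using h by (intro mult_left_mono) auto
      moreover have "a = h / 2 * (l\<^sup>2 * (exp x)\<^sup>2 * 1)"
        by (simp add: a_def exp_double)
      moreover have "h / 2 * R\<^sup>2 = h / 2 * (K\<^sup>2 * (exp x)\<^sup>2 * (cosh b)\<^sup>2)"
        by (simp add: R_def power_mult_distrib)
      ultimately show ?thesis by (simp only:)
    qed
    \<comment> \<open>The first-order terms cancel: \<open>a = h / 2 (Z\<^sup>2 - Z'\<^sup>2)\<close> turns \<open>Z'\<^sup>2\<close> into \<open>Z\<^sup>2\<close>.\<close>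
    have split: "of_real (exp (- a)) * I1 - I2
      = of_real (exp (- a)) * (I1 - exp (- Z) * (1 + of_real (h / 2) * (Z\<^sup>2 - Z)))
        - (I2 - exp (- Z) * (1 + of_real (h / 2) * (Z'\<^sup>2 - Z)))
        + exp (- Z) * (of_real (exp (- a) - 1 + a) + of_real (h / 2 * (exp (- a) - 1)) * (Z\<^sup>2 - Z))"
    proof -
      define H W A where "H = complex_of_real (h / 2)" and "W = complex_of_real (exp (- a))"
        and "A = complex_of_real a"
      have A: "A = H * (Z\<^sup>2 - Z'\<^sup>2)"
        unfolding pyth by (simp add: H_def A_def a_def)
      have "W * I1 - I2 = W * (I1 - exp (- Z) * (1 + H * (Z\<^sup>2 - Z)))
          - (I2 - exp (- Z) * (1 + H * (Z'\<^sup>2 - Z)))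
          + exp (- Z) * ((W - 1 + A) + (H * (W - 1)) * (Z\<^sup>2 - Z))"
        unfolding A by (simp add: algebra_simps)
      thus ?thesis
        by (simp only: H_def W_def A_def of_real_add of_real_diff of_real_mult of_real_1)
    qed
    have "norm (exp (- Z) * (of_real (exp (- a) - 1 + a) + of_real (h / 2 * (exp (- a) - 1)) * (Z\<^sup>2 - Z)))
        \<le> exp (- (\<kappa> * R)) * ((h / 2 * R\<^sup>2)\<^sup>2 + h / 2 * (h / 2 * R\<^sup>2) * (R\<^sup>2 + R))"
    proof -
      have "norm (complex_of_real (exp (- a) - 1 + a)) \<le> (h / 2 * R\<^sup>2)\<^sup>2"
        using exp_neg_remainder(2)[OF a0] power_mono[OF a_le a0, of 2]
        by (simp del: of_real_add of_real_diff)
      moreover have "norm (complex_of_real (h / 2 * (exp (- a) - 1)) * (Z\<^sup>2 - Z))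
          \<le> (h / 2 * (h / 2 * R\<^sup>2)) * (R\<^sup>2 + R)"
        unfolding norm_mult[of "complex_of_real _"]
      proof (rule mult_mono)
        show "norm (complex_of_real (h / 2 * (exp (- a) - 1))) \<le> h / 2 * (h / 2 * R\<^sup>2)"
          unfolding norm_of_real abs_mult using exp_neg_remainder(1)[OF a0] a_le h
          by (intro mult_mono) auto
        have "norm (Z\<^sup>2 - Z) \<le> (norm Z)\<^sup>2 + norm Z"
          by (rule order_trans[OF norm_triangle_ineq4]) (simp add: norm_power)
        also have "\<dots> \<le> R\<^sup>2 + R"
          by (intro add_mono power_mono Z) auto
        finally show "norm (Z\<^sup>2 - Z) \<le> R\<^sup>2 + R" .
      qed (use h in auto)
      ultimately have "norm (complex_of_real (exp (- a) - 1 + a)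
            + of_real (h / 2 * (exp (- a) - 1)) * (Z\<^sup>2 - Z))
          \<le> (h / 2 * R\<^sup>2)\<^sup>2 + h / 2 * (h / 2 * R\<^sup>2) * (R\<^sup>2 + R)"
        by (rule norm_triangle_mono)
      moreover have "norm (exp (- Z)) \<le> exp (- (\<kappa> * R))"
        using Z(3) by simp
      ultimately show ?thesis
        unfolding norm_mult[of "exp (- Z)"] by (intro mult_mono) auto
    qed
    also have "\<dots> = h\<^sup>2 / 2 * (R ^ 4 * exp (- (\<kappa> * R))) + h\<^sup>2 / 4 * (R ^ 3 * exp (- (\<kappa> * R)))"
      by (simp add: field_simps power2_eq_square power3_eq_cube power4_eq_xxxx)
    also have "\<dots> \<le> h\<^sup>2 / 2 * (fact 4 / \<kappa>^4) + h\<^sup>2 / 4 * (fact 3 / \<kappa>^3)"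
      by (intro add_mono mult_left_mono power_times_exp_le R0 \<kappa>) auto
    also have "\<dots> = (12 / \<kappa>^4 + 3 / (2 * \<kappa>^3)) * h\<^sup>2"
      by (simp add: fact_numeral algebra_simps)
    finally have d3: "norm (exp (- Z) * (of_real (exp (- a) - 1 + a)
        + of_real (h / 2 * (exp (- a) - 1)) * (Z\<^sup>2 - Z))) \<le> (12 / \<kappa>^4 + 3 / (2 * \<kappa>^3)) * h\<^sup>2" .
    have d1': "norm (of_real (exp (- a)) * (I1 - exp (- Z) * (1 + of_real (h / 2) * (Z\<^sup>2 - Z))))
        \<le> 1 * (C * (h * sqrt h))"
      unfolding norm_mult[of "of_real (exp (- a))"] using a0 d1
      by (intro mult_mono d1) auto
    have "norm (of_real (exp (- a)) * I1 - I2)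
        \<le> 1 * (C * (h * sqrt h)) + C * (h * sqrt h) + (12 / \<kappa>^4 + 3 / (2 * \<kappa>^3)) * h\<^sup>2"
      unfolding split
      by (intro norm_triangle_mono order_trans[OF norm_triangle_ineq4] add_mono d1' d2 d3)
    thus ?thesis
      by (simp add: walk_step_def I1_def I2_def a_def scaleR_conv_of_real algebra_simps)
  qed
  show ?thesis
    by (intro exI allI impI) (rule step)
qed


section \<open>Gaussian steps with drift\<close>

text \<open>
  The one-step Cameron--Martin formula: the density of the Gaussian with mean \<open>c h\<close> and variance
  \<open>h\<close> at \<open>y\<close> is the centred one times \<open>exp (c y - c\<^sup>2 h / 2)\<close>.
\<close>

lemma walk_step_drift:
  fixes f :: "real \<Rightarrow> real"
  assumes h: "h > 0" and [measurable]: "f \<in> borel_measurable borel"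
  shows "walk_step w (gauss (c * h) (sqrt h)) f x
    = exp (- (c\<^sup>2 * h / 2)) * exp (- (c * x)) * walk_step w (gauss 0 (sqrt h)) (\<lambda>x. exp (c * x) * f x) x"
proof -
  have density: "normal_density (c * h) (sqrt h) y
      = exp (- (c\<^sup>2 * h / 2)) * (normal_density 0 (sqrt h) y * exp (c * y))" for y
  proof -
    have "- (y - c * h)\<^sup>2 / (2 * h) = - (c\<^sup>2 * h / 2) + (- y\<^sup>2 / (2 * h) + c * y)"
      using h by (simp add: field_simps power2_eq_square)
    hence "exp (- (y - c * h)\<^sup>2 / (2 * h))
        = exp (- (c\<^sup>2 * h / 2)) * (exp (- y\<^sup>2 / (2 * h)) * exp (c * y))"
      by (simp only: exp_add)
    thus ?thesis
      using h by (simp add: normal_density_def)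
  qed
  have "(\<integral>y. f (x + y) \<partial>gauss (c * h) (sqrt h))
      = (\<integral>y. exp (- (c\<^sup>2 * h / 2)) * exp (- (c * x)) *
          (normal_density 0 (sqrt h) y * (exp (c * (x + y)) * f (x + y))) \<partial>lborel)"
    by (subst integral_density)
      (auto simp: density exp_add exp_minus field_simps intro!: Bochner_Integration.integral_cong)
  also have "\<dots> = exp (- (c\<^sup>2 * h / 2)) * exp (- (c * x)) *
      (\<integral>y. exp (c * (x + y)) * f (x + y) \<partial>gauss 0 (sqrt h))"
    by (subst integral_density) auto
  finally show ?thesis
    by (simp add: walk_step_def)
qed

text \<open>
  The factors \<open>exp (- c x)\<close> and \<open>exp (c x)\<close> of consecutive steps cancel, so iterating the one-step
  formula conjugates the iterated operator by \<open>exp (c x)\<close>.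
\<close>

lemma walk_step_funpow_drift:
  fixes f :: "real \<Rightarrow> real"
  assumes h: "h > 0" and w: "w \<in> borel_measurable borel" "\<And>x. 0 \<le> w x" "\<And>x. w x \<le> 1"
    and f: "f \<in> borel_measurable borel" "\<And>x. norm (f x) \<le> C"
  shows "(walk_step w (gauss (c * h) (sqrt h)) ^^ n) f x
    = exp (- (c\<^sup>2 * (real n * h) / 2)) * exp (- (c * x)) *
        (walk_step w (gauss 0 (sqrt h)) ^^ n) (\<lambda>x. exp (c * x) * f x) x"
proof (induction n arbitrary: x)
  case 0
  show ?case by (simp flip: exp_add)
next
  case (Suc n)
  let ?T0 = "walk_step w (gauss 0 (sqrt h))" and ?Tc = "walk_step w (gauss (c * h) (sqrt h))"
  let ?q = "exp (- (c\<^sup>2 * (real n * h) / 2))"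
  interpret real_distribution "gauss (c * h) (sqrt h)"
    using h by (intro real_distribution_gauss) simp
  have "(?Tc ^^ Suc n) f x = ?Tc ((?Tc ^^ n) f) x"
    by simp
  also have "\<dots> = exp (- (c\<^sup>2 * h / 2)) * exp (- (c * x)) * ?T0 (\<lambda>x. exp (c * x) * (?Tc ^^ n) f x) x"
    by (rule walk_step_drift[OF h walk_step_funpow_bounded_borel(1)[OF w f]])
  also have "(\<lambda>x. exp (c * x) * (?Tc ^^ n) f x) = (\<lambda>x. ?q * (?T0 ^^ n) (\<lambda>x. exp (c * x) * f x) x)"
    unfolding Suc.IH by (rule ext) (simp add: exp_minus field_simps)
  also have "?T0 \<dots> x = ?q * (?T0 ^^ Suc n) (\<lambda>x. exp (c * x) * f x) x"
    by (simp add: walk_step_def)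
  finally have "(?Tc ^^ Suc n) f x = exp (- (c\<^sup>2 * h / 2)) * exp (- (c * x)) *
      (?q * (?T0 ^^ Suc n) (\<lambda>x. exp (c * x) * f x) x)" .
  moreover have "exp (- (c\<^sup>2 * (real (Suc n) * h) / 2)) = exp (- (c\<^sup>2 * h / 2)) * ?q"
    by (simp add: algebra_simps add_divide_distrib flip: exp_add)
  ultimately show ?case
    by (simp only: mult_ac)
qed


section \<open>Exponential functionals of Brownian motion\<close>

lemma Riemann_sums_tendsto_LINT:
  fixes g :: "real \<Rightarrow> real"
  assumes t: "t > 0" and g: "continuous_on {0..t} g"
  shows "(\<lambda>n. \<Sum>j<Suc n. t / real (Suc n) * g (real j * (t / real (Suc n))))
    \<longlonglongrightarrow> (LINT u:{0..t}|lborel. g u)"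
proof -
  have eq: "(LINT u:{0..t}|lborel. g u) = integral {0..t} g"
    by (rule set_borel_integral_eq_integral(2)[OF borel_integrable_atLeastAtMost'[OF g]])
  have mesh0: "(\<lambda>n. t / real (Suc n)) \<longlonglongrightarrow> 0"
    using LIMSEQ_Suc[OF lim_const_over_n[of t]] by simp
  show ?thesis
    unfolding eq
  proof (rule metric_LIMSEQ_I)
    fix \<epsilon> :: real
    assume \<epsilon>: "\<epsilon> > 0"
    define \<epsilon>' where "\<epsilon>' = \<epsilon> / (2 * t)"
    have \<epsilon>': "\<epsilon>' > 0" "\<epsilon>' * t < \<epsilon>"
      using \<epsilon> t by (simp_all add: \<epsilon>'_def)
    have "uniformly_continuous_on {0..t} g"
      using g by (intro compact_uniformly_continuous) auto
    then obtain d where d: "d > 0"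
      "\<And>u v. u \<in> {0..t} \<Longrightarrow> v \<in> {0..t} \<Longrightarrow> dist v u < d \<Longrightarrow> dist (g v) (g u) < \<epsilon>'"
      using \<epsilon>'(1) unfolding uniformly_continuous_on_def by metis
    from metric_LIMSEQ_D[OF mesh0 d(1)] obtain n0 where
      n0: "\<And>n. n \<ge> n0 \<Longrightarrow> t / real (Suc n) < d"
      using t by auto
    show "\<exists>n0. \<forall>n\<ge>n0. dist (\<Sum>j<Suc n. t / real (Suc n) * g (real j * (t / real (Suc n))))
        (integral {0..t} g) < \<epsilon>"
    proof (intro exI allI impI)
      fix n assume n: "n0 \<le> n"
      define h where "h = t / real (Suc n)"
      have h: "h > 0" "h < d" "real (Suc n) * h = t"
        using t n0[OF n] by (simp_all add: h_def del: of_nat_Suc)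
      have "m \<le> Suc n \<Longrightarrow> \<bar>integral {0..real m * h} g - (\<Sum>j<m. h * g (real j * h))\<bar>
          \<le> real m * h * \<epsilon>'" for m
      proof (induction m)
        case (Suc m)
        let ?a = "real m * h" and ?b = "real (Suc m) * h"
        have ab: "0 \<le> ?a" "?a \<le> ?b" "?b - ?a = h"
          using h(1) by (simp_all add: algebra_simps)
        have "?b \<le> real (Suc n) * h"
          using Suc.prems h(1) by (intro mult_right_mono) auto
        hence bt: "?b \<le> t" using h(3) by simp
        have gb: "continuous_on {0..?b} g"
          by (rule continuous_on_subset[OF g]) (use bt in auto)
        have gab: "continuous_on {?a..?b} g"
          by (rule continuous_on_subset[OF g]) (use bt ab in auto)
        have "norm (integral {?a..?b} (\<lambda>u. g u - g ?a)) \<le> \<epsilon>' * (?b - ?a)"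
        proof (rule integral_bound[OF ab(2)])
          show "continuous_on {?a..?b} (\<lambda>u. g u - g ?a)"
            by (intro continuous_intros gab)
          show "norm (g u - g ?a) \<le> \<epsilon>'" if "u \<in> {?a..?b}" for u
          proof -
            have "dist u ?a < d" "u \<in> {0..t}" "?a \<in> {0..t}"
              using that ab order_trans[OF ab(1), of u] order_trans[OF ab(2) bt] bt h(2)
              by (auto simp: dist_real_def simp del: of_nat_Suc)
            thus ?thesis
              using d(2)[of ?a u] by (simp add: dist_real_def)
          qed
        qed
        also have "integral {?a..?b} (\<lambda>u. g u - g ?a) = integral {?a..?b} g - h * g ?a"
          using ab gab
          by (subst integral_diff) (auto intro: integrable_continuous_real simp del: of_nat_Suc)
        finally have local: "\<bar>integral {?a..?b} g - h * g ?a\<bar> \<le> h * \<epsilon>'"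
          using ab(3) by (simp add: mult.commute)
        have "integral {0..?a} g + integral {?a..?b} g = integral {0..?b} g"
          by (rule Henstock_Kurzweil_Integration.integral_combine[OF ab(1,2)]) (rule integrable_continuous_real[OF gb])
        moreover have "\<bar>integral {0..?a} g - (\<Sum>j<m. h * g (real j * h))\<bar> \<le> real m * h * \<epsilon>'"
          using Suc by simp
        moreover have "real (Suc m) * h * \<epsilon>' = real m * h * \<epsilon>' + h * \<epsilon>'"
          by (simp add: algebra_simps)
        moreover have "(\<Sum>j<Suc m. h * g (real j * h)) = (\<Sum>j<m. h * g (real j * h)) + h * g ?a"
          by simp
        ultimately show ?case
          using local unfolding abs_le_iff by linarith
      qed simp
      from this[of "Suc n"] have "\<bar>integral {0..t} g - (\<Sum>j<Suc n. h * g (real j * h))\<bar> \<le> t * \<epsilon>'"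
        unfolding h(3) by simp
      thus "dist (\<Sum>j<Suc n. t / real (Suc n) * g (real j * (t / real (Suc n)))) (integral {0..t} g) < \<epsilon>"
        using \<epsilon>'(2) unfolding h_def[symmetric] dist_real_def abs_minus_commute[of _ "integral {0..t} g"]
        by (simp only: mult.commute[of \<epsilon>'] le_less_trans)
    qed
  qed
qed

locale brownian_motion =
  fixes M :: "'a measure" and B :: "real \<Rightarrow> 'a \<Rightarrow> real"
  assumes standard: "standard_brownian_motion M B"

sublocale brownian_motion \<subseteq> prob_space M
  using standard by (simp add: standard_brownian_motion_def)

context brownian_motion
begin

lemma measurable_B [measurable]: "s \<ge> 0 \<Longrightarrow> B s \<in> borel_measurable M"
  using standard by (simp add: standard_brownian_motion_def)

lemma B_zero: "\<omega> \<in> space M \<Longrightarrow> B 0 \<omega> = 0"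
  using standard by (simp add: standard_brownian_motion_def)

lemma continuous_B: "\<omega> \<in> space M \<Longrightarrow> continuous_on {0..} (\<lambda>s. B s \<omega>)"
  using standard by (simp add: standard_brownian_motion_def)

lemma random_walk_increments:
  assumes h: "h > 0"
  shows "random_walk M (gauss (c * h) (sqrt h))
    (\<lambda>i \<omega>. B (real (Suc i) * h) \<omega> - B (real i * h) \<omega> + c * h)"
proof -
  interpret N: real_distribution "gauss (c * h) (sqrt h)"
    using h by (intro real_distribution_gauss) simp
  show ?thesis
  proof
    fix n
    have "0 \<le> real 0 * h \<and> (\<forall>i<n. real i * h < real (Suc i) * h)"
      using h by simp
    hence "indep_vars (\<lambda>_. borel) (\<lambda>i \<omega>. B (real (Suc i) * h) \<omega> - B (real i * h) \<omega>) {..<n}"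
      using standard[unfolded standard_brownian_motion_def, THEN conjunct2, THEN conjunct2,
        THEN conjunct2, THEN conjunct1, rule_format, of "\<lambda>i. real i * h" n] by simp
    thus "indep_vars (\<lambda>_. borel)
        (\<lambda>i \<omega>. B (real (Suc i) * h) \<omega> - B (real i * h) \<omega> + c * h) {..<n}"
      by (rule indep_vars_compose2[where Y = "\<lambda>_ x. x + c * h"]) auto
  next
    fix i
    have "real i * h < real (Suc i) * h" "0 \<le> real i * h"
      using h by auto
    hence "distributed M lborel (\<lambda>\<omega>. B (real (Suc i) * h) \<omega> - B (real i * h) \<omega>)
        (normal_density 0 (sqrt (real (Suc i) * h - real i * h)))"
      using standard unfolding standard_brownian_motion_def by blast
    moreover have "real (Suc i) * h - real i * h = h"
      by (simp add: algebra_simps)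
    ultimately have "distributed M lborel (\<lambda>\<omega>. B (real (Suc i) * h) \<omega> - B (real i * h) \<omega>)
        (normal_density 0 (sqrt h))"
      by simp
    from normal_density_affine[OF this, of 1 "c * h"]
    have "distributed M lborel (\<lambda>\<omega>. B (real (Suc i) * h) \<omega> - B (real i * h) \<omega> + c * h)
        (normal_density (c * h) (sqrt h))"
      using h by (simp add: add.commute)
    from distributed_distr_eq_density[OF this]
    show "distr M borel (\<lambda>\<omega>. B (real (Suc i) * h) \<omega> - B (real i * h) \<omega> + c * h)
        = gauss (c * h) (sqrt h)"
      by (subst distr_cong[OF refl sets_lborel[symmetric] refl]) auto
  qed
qed

lemma sum_increments:
  assumes "\<omega> \<in> space M"
  shows "(\<Sum>i<n. B (real (Suc i) * h) \<omega> - B (real i * h) \<omega> + c * h)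
    = B (real n * h) \<omega> + c * (real n * h)"
  unfolding sum.distrib sum_lessThan_telescope[where f = "\<lambda>i. B (real i * h) \<omega>"]
  using B_zero[OF assms] by simp

definition exp_functional :: "real \<Rightarrow> real \<Rightarrow> real \<Rightarrow> 'a \<Rightarrow> real" where
  "exp_functional c l t \<omega> = exp (- (l\<^sup>2 / 2 * (LINT u:{0..t}|lborel. exp (2 * (B u \<omega> + c * u)))))"

lemma exp_functional_at_zero: "exp_functional c l 0 \<omega> = 1"
proof -
  have "(LINT u:{0..0}|lborel. exp (2 * (B u \<omega> + c * u))) = 0"
    unfolding set_lebesgue_integral_def
    by (rule integral_eq_zero_AE) (use AE_lborel_singleton[of 0] in \<open>auto elim!: eventually_mono\<close>)
  thus ?thesis
    by (simp only: exp_functional_def) simp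
qed

text \<open>
  The factor that a time interval of length \<open>h\<close>, starting at position \<open>x\<close>, contributes to
  \<^const>\<open>exp_functional\<close> when the time integral is replaced by a left Riemann sum.
\<close>

abbreviation decay :: "real \<Rightarrow> real \<Rightarrow> real \<Rightarrow> real" where
  "decay l h x \<equiv> exp (- (l\<^sup>2 / 2 * h * exp (2 * x)))"

lemma exp_functional_approx:
  assumes t: "t > 0" and \<omega>: "\<omega> \<in> space M"
  shows "(\<lambda>n. \<Prod>j<Suc n. decay l (t / real (Suc n))
      (B (real j * (t / real (Suc n))) \<omega> + c * (real j * (t / real (Suc n)))))
    \<longlonglongrightarrow> exp_functional c l t \<omega>"
proof -
  have "continuous_on {0..t} (\<lambda>u. B u \<omega>)"
    by (rule continuous_on_subset[OF continuous_B[OF \<omega>]]) auto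
  hence "continuous_on {0..t} (\<lambda>u. exp (2 * (B u \<omega> + c * u)))"
    by (intro continuous_intros)
  from Riemann_sums_tendsto_LINT[OF t this]
  have "(\<lambda>n. exp (- (l\<^sup>2 / 2 * (\<Sum>j<Suc n. t / real (Suc n) * exp (2 * (B (real j * (t / real (Suc n))) \<omega>
      + c * (real j * (t / real (Suc n)))))))))
    \<longlonglongrightarrow> exp_functional c l t \<omega>"
    unfolding exp_functional_def by (intro tendsto_intros)
  thus ?thesis
    by (simp only: exp_sum[OF finite_lessThan, symmetric] sum_negf sum_distrib_left mult.assoc)
qed

lemma exp_functional_measurable [measurable]:
  assumes t: "t \<ge> 0"
  shows "exp_functional c l t \<in> borel_measurable M"
proof (cases "t = 0")
  case True
  thus ?thesis
    by (simp add: exp_functional_at_zero cong: measurable_cong)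
next
  case False
  show ?thesis
  proof (rule borel_measurable_LIMSEQ_metric)
    show "(\<lambda>\<omega>. \<Prod>j<Suc n. decay l (t / real (Suc n))
        (B (real j * (t / real (Suc n))) \<omega> + c * (real j * (t / real (Suc n))))) \<in> borel_measurable M" for n
    proof (rule borel_measurable_prod)
      fix j
      have [measurable]: "B (real j * (t / real (Suc n))) \<in> borel_measurable M"
        using t by (intro measurable_B) simp
      show "(\<lambda>\<omega>. decay l (t / real (Suc n))
        (B (real j * (t / real (Suc n))) \<omega> + c * (real j * (t / real (Suc n))))) \<in> borel_measurable M"
        by measurable
    qed
    show "(\<lambda>n. \<Prod>j<Suc n. decay l (t / real (Suc n))
        (B (real j * (t / real (Suc n))) \<omega> + c * (real j * (t / real (Suc n)))))
      \<longlonglongrightarrow> exp_functional c l t \<omega>" if "\<omega> \<in> space M" for \<omega>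
      using t False that by (intro exp_functional_approx) auto
  qed
qed

lemma exp_functional_bounds: "0 \<le> exp_functional c l t \<omega>" "exp_functional c l t \<omega> \<le> 1"
proof -
  have "0 \<le> (LINT u:{0..t}|lborel. exp (2 * (B u \<omega> + c * u)))"
    unfolding set_lebesgue_integral_def by (intro integral_nonneg_AE) auto
  thus "0 \<le> exp_functional c l t \<omega>" "exp_functional c l t \<omega> \<le> 1"
    by (simp_all add: exp_functional_def)
qed

text \<open>
  Path continuity makes the Riemann sums converge for each path, and the weights are
  at most \<open>1\<close>, so dominated convergence applies.  This is the only passage from discrete to
  continuous time: identities between iterated transition operators become identities between
  expectations of exponential functionals.
\<close>

lemma expectation_walk_tendsto:
  fixes f :: "real \<Rightarrow> 'b::{banach, second_countable_topology}"
  assumes t: "t > 0" and f [measurable]: "f \<in> borel_measurable borel" and bd: "\<And>x. norm (f x) \<le> C"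
  shows "(\<lambda>n. (walk_step (decay l (t / real (Suc n)))
        (gauss (c * (t / real (Suc n))) (sqrt (t / real (Suc n)))) ^^ Suc n) f 0)
    \<longlonglongrightarrow> (\<integral>\<omega>. exp_functional c l t \<omega> *\<^sub>R f (B t \<omega> + c * t) \<partial>M)"
proof -
  have [measurable]: "B t \<in> borel_measurable M"
    using t by (intro measurable_B) simp
  let ?W = "\<lambda>n \<omega>. \<Prod>j<Suc n. decay l (t / real (Suc n))
      (B (real j * (t / real (Suc n))) \<omega> + c * (real j * (t / real (Suc n))))"
  have W [measurable]: "?W n \<in> borel_measurable M" for n
  proof (rule borel_measurable_prod)
    fix j
    have [measurable]: "B (real j * (t / real (Suc n))) \<in> borel_measurable M"
      using t by (intro measurable_B) simp
    show "(\<lambda>\<omega>. decay l (t / real (Suc n))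
      (B (real j * (t / real (Suc n))) \<omega> + c * (real j * (t / real (Suc n))))) \<in> borel_measurable M"
      by measurable
  qed
  have W_bd: "norm (?W n \<omega>) \<le> 1" for n \<omega>
  proof -
    have "?W n \<omega> \<le> 1" using t by (intro prod_le_1) auto
    moreover have "0 \<le> ?W n \<omega>" by (intro prod_nonneg) auto
    ultimately show ?thesis by (simp del: prod.lessThan_Suc)
  qed
  have "(\<lambda>n. \<integral>\<omega>. ?W n \<omega> *\<^sub>R f (B t \<omega> + c * t) \<partial>M)
      \<longlonglongrightarrow> (\<integral>\<omega>. exp_functional c l t \<omega> *\<^sub>R f (B t \<omega> + c * t) \<partial>M)"
  proof (rule integral_dominated_convergence[where w = "\<lambda>_. C"])
    have fB: "(\<lambda>\<omega>. f (B t \<omega> + c * t)) \<in> borel_measurable M"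
      by (rule measurable_compose[OF _ f]) measurable
    show "(\<lambda>\<omega>. exp_functional c l t \<omega> *\<^sub>R f (B t \<omega> + c * t)) \<in> borel_measurable M"
      using t by (intro borel_measurable_scaleR fB exp_functional_measurable) simp
    show "(\<lambda>\<omega>. ?W n \<omega> *\<^sub>R f (B t \<omega> + c * t)) \<in> borel_measurable M" for n
      by (intro borel_measurable_scaleR W fB)
    show "AE \<omega> in M. (\<lambda>n. ?W n \<omega> *\<^sub>R f (B t \<omega> + c * t))
        \<longlonglongrightarrow> exp_functional c l t \<omega> *\<^sub>R f (B t \<omega> + c * t)"
      by (intro AE_I2 tendsto_scaleR exp_functional_approx t tendsto_const)
    show "AE \<omega> in M. norm (?W n \<omega> *\<^sub>R f (B t \<omega> + c * t)) \<le> C" for n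
    proof (rule AE_I2)
      fix \<omega>
      have "norm (?W n \<omega>) * norm (f (B t \<omega> + c * t)) \<le> 1 * C"
        by (intro mult_mono W_bd bd) auto
      thus "norm (?W n \<omega> *\<^sub>R f (B t \<omega> + c * t)) \<le> C"
        by (simp only: norm_scaleR real_norm_def mult_1)
    qed
  qed simp
  moreover have "(\<integral>\<omega>. ?W n \<omega> *\<^sub>R f (B t \<omega> + c * t) \<partial>M)
      = (walk_step (decay l (t / real (Suc n)))
          (gauss (c * (t / real (Suc n))) (sqrt (t / real (Suc n)))) ^^ Suc n) f 0" for n
  proof -
    define h where "h = t / real (Suc n)"
    have h: "h > 0" "real (Suc n) * h = t"
      using t by (simp_all add: h_def del: of_nat_Suc)
    interpret R: random_walk M "gauss (c * h) (sqrt h)"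
      "\<lambda>i \<omega>. B (real (Suc i) * h) \<omega> - B (real i * h) \<omega> + c * h"
      by (rule random_walk_increments[OF h(1)])
    have "(walk_step (decay l h) (gauss (c * h) (sqrt h)) ^^ Suc n) f 0
        = (\<integral>\<omega>. (\<Prod>j<Suc n. decay l h (\<Sum>i<j. B (real (Suc i) * h) \<omega> - B (real i * h) \<omega> + c * h)) *\<^sub>R
            f (\<Sum>i<Suc n. B (real (Suc i) * h) \<omega> - B (real i * h) \<omega> + c * h) \<partial>M)"
      using h(1) by (intro R.expectation_walk[where c = C, symmetric] f bd) auto
    also have "\<dots> = (\<integral>\<omega>. (\<Prod>j<Suc n. decay l h (B (real j * h) \<omega> + c * (real j * h))) *\<^sub>R
        f (B t \<omega> + c * t) \<partial>M)"
      by (intro Bochner_Integration.integral_cong refl) (simp only: sum_increments h(2))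
    finally show ?thesis
      by (simp only: h_def)
  qed
  ultimately show ?thesis
    by (simp only:)
qed

text \<open>
  Both sides are limits of the same iterated operators, by \<open>walk_step_funpow_drift\<close>.  At time \<open>0\<close>
  the sampled increments are degenerate, so that case is checked directly.
\<close>

lemma exp_functional_Cameron_Martin:
  fixes f :: "real \<Rightarrow> real"
  assumes t: "t \<ge> 0" and f: "f \<in> borel_measurable borel" "\<And>x. norm (f x) \<le> C"
    and ef: "\<And>x. norm (exp (c * x) * f x) \<le> C'"
  shows "(\<integral>\<omega>. exp_functional c l t \<omega> * f (B t \<omega> + c * t) \<partial>M)
    = exp (- (c\<^sup>2 * t / 2)) * (\<integral>\<omega>. exp_functional 0 l t \<omega> * (exp (c * B t \<omega>) * f (B t \<omega>)) \<partial>M)"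
proof (cases "t = 0")
  case True
  have "(\<integral>\<omega>. exp_functional c l 0 \<omega> * f (B 0 \<omega> + c * 0) \<partial>M)
      = (\<integral>\<omega>. exp_functional 0 l 0 \<omega> * (exp (c * B 0 \<omega>) * f (B 0 \<omega>)) \<partial>M)"
    by (intro Bochner_Integration.integral_cong refl)
      (simp add: B_zero exp_functional_at_zero)
  thus ?thesis using True by simp
next
  case False
  hence t: "t > 0" using t by simp
  note [measurable] = f(1)
  let ?h = "\<lambda>n. t / real (Suc n)"
  have "(\<lambda>n. (walk_step (decay l (?h n)) (gauss (c * ?h n) (sqrt (?h n))) ^^ Suc n) f 0)
      \<longlonglongrightarrow> (\<integral>\<omega>. exp_functional c l t \<omega> *\<^sub>R f (B t \<omega> + c * t) \<partial>M)"
    by (rule expectation_walk_tendsto[OF t f])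
  moreover have "(walk_step (decay l (?h n)) (gauss (c * ?h n) (sqrt (?h n))) ^^ Suc n) f 0
      = exp (- (c\<^sup>2 * t / 2)) *
        (walk_step (decay l (?h n)) (gauss 0 (sqrt (?h n))) ^^ Suc n) (\<lambda>x. exp (c * x) * f x) 0" for n
  proof -
    have hn: "real (Suc n) * ?h n = t" "?h n > 0"
      using t by (simp_all del: of_nat_Suc)
    have "(walk_step (decay l (?h n)) (gauss (c * ?h n) (sqrt (?h n))) ^^ Suc n) f 0
        = exp (- (c\<^sup>2 * (real (Suc n) * ?h n) / 2)) * exp (- (c * 0)) *
          (walk_step (decay l (?h n)) (gauss 0 (sqrt (?h n))) ^^ Suc n) (\<lambda>x. exp (c * x) * f x) 0"
      using t by (intro walk_step_funpow_drift[where C = C] f) auto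
    thus ?thesis
      by (simp only: hn(1) mult_zero_right minus_zero exp_zero mult_1_right)
  qed
  ultimately have lim1: "(\<lambda>n. exp (- (c\<^sup>2 * t / 2)) *
        (walk_step (decay l (?h n)) (gauss 0 (sqrt (?h n))) ^^ Suc n) (\<lambda>x. exp (c * x) * f x) 0)
      \<longlonglongrightarrow> (\<integral>\<omega>. exp_functional c l t \<omega> *\<^sub>R f (B t \<omega> + c * t) \<partial>M)"
    by (simp only:)
  have "(\<lambda>n. (walk_step (decay l (?h n)) (gauss (0 * ?h n) (sqrt (?h n))) ^^ Suc n) (\<lambda>x. exp (c * x) * f x) 0)
      \<longlonglongrightarrow> (\<integral>\<omega>. exp_functional 0 l t \<omega> *\<^sub>R (exp (c * (B t \<omega> + 0 * t)) * f (B t \<omega> + 0 * t)) \<partial>M)"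
    by (rule expectation_walk_tendsto[OF t _ ef]) measurable
  from tendsto_mult_left[OF this, of "exp (- (c\<^sup>2 * t / 2))"]
  have lim2: "(\<lambda>n. exp (- (c\<^sup>2 * t / 2)) *
        (walk_step (decay l (?h n)) (gauss 0 (sqrt (?h n))) ^^ Suc n) (\<lambda>x. exp (c * x) * f x) 0)
      \<longlonglongrightarrow> exp (- (c\<^sup>2 * t / 2)) *
        (\<integral>\<omega>. exp_functional 0 l t \<omega> *\<^sub>R (exp (c * B t \<omega>) * f (B t \<omega>)) \<partial>M)"
    by (simp only: mult_zero_left add_0_right)
  from LIMSEQ_unique[OF lim1 lim2] show ?thesis
    by simp
qed

text \<open>
  The joint law of \<open>B t\<close> and \<open>\<integral>\<^sub>0\<^sup>t exp (2 B u) du\<close> enters on the left, the law of \<open>B t\<close> alone on the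
  right.  The accumulated error of the exchange over \<open>n\<close> steps of length \<open>h = t / n\<close> is at most
  \<open>n (C1 h\<^sup>2 + C2 h powr (3/2))\<close>, which is \<open>C1 t h + C2 t sqrt h\<close>.
\<close>

lemma exp_functional_swap:
  fixes g l :: real and s :: complex
  assumes t: "t \<ge> 0" and s: "s\<^sup>2 = of_real (g\<^sup>2 - l\<^sup>2)" "\<bar>Re s\<bar> < g"
  shows "complex_of_real (\<integral>\<omega>. exp_functional 0 l t \<omega> * exp (- (g * exp (B t \<omega>))) \<partial>M)
    = (\<integral>\<omega>. swap_kernel g s 0 (B t \<omega>) \<partial>M)"
proof (cases "t = 0")
  case True
  have "complex_of_real (\<integral>\<omega>. exp_functional 0 l t \<omega> * exp (- (g * exp (B t \<omega>))) \<partial>M)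
      = (\<integral>\<omega>. complex_of_real (exp_functional 0 l t \<omega> * exp (- (g * exp (B t \<omega>)))) \<partial>M)"
    by (simp only: integral_complex_of_real)
  also have "\<dots> = (\<integral>\<omega>. swap_kernel g s 0 (B t \<omega>) \<partial>M)"
    by (intro Bochner_Integration.integral_cong refl)
      (simp add: True B_zero exp_functional_at_zero swap_kernel_zero)
  finally show ?thesis .
next
  case False
  hence t: "t > 0" using t by simp
  let ?h = "\<lambda>n. t / real (Suc n)"
  let ?I = "\<integral>\<omega>. swap_kernel g s 0 (B t \<omega>) \<partial>M"
  let ?a = "\<lambda>n. (walk_step (decay l (?h n)) (gauss 0 (sqrt (?h n))) ^^ Suc n) (\<lambda>x. swap_kernel g s x 0) 0"
  obtain C1 C2 where one_step: "\<And>h x b. h > 0 \<Longrightarrow>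
    norm (walk_step (decay l h) (gauss 0 (sqrt h)) (\<lambda>x. swap_kernel g s x b) x
      - (\<integral>y. swap_kernel g s x (b + y) \<partial>gauss 0 (sqrt h))) \<le> C1 * h\<^sup>2 + C2 * (h * sqrt h)"
    using swap_kernel_one_step[OF s] by blast
  have kernel_meas [measurable]: "(\<lambda>x. swap_kernel g s x 0) \<in> borel_measurable borel"
    by measurable
  have "(\<lambda>n. (walk_step (decay l (?h n)) (gauss (0 * ?h n) (sqrt (?h n))) ^^ Suc n) (\<lambda>x. swap_kernel g s x 0) 0)
      \<longlonglongrightarrow> (\<integral>\<omega>. exp_functional 0 l t \<omega> *\<^sub>R swap_kernel g s (B t \<omega> + 0 * t) 0 \<partial>M)"
    by (rule expectation_walk_tendsto[OF t kernel_meas norm_swap_kernel_le[OF s(2)]])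
  hence lim1: "?a \<longlonglongrightarrow> (\<integral>\<omega>. exp_functional 0 l t \<omega> *\<^sub>R swap_kernel g s (B t \<omega>) 0 \<partial>M)"
    by (simp only: mult_zero_left add_0_right)
  have err: "norm (?a n - ?I) \<le> C1 * t * ?h n + C2 * t * sqrt (?h n)" for n
  proof -
    define h where "h = ?h n"
    have h: "h > 0" "real (Suc n) * h = t"
      using t by (simp_all add: h_def del: of_nat_Suc)
    let ?D = "\<lambda>i \<omega>. B (real (Suc i) * h) \<omega> - B (real i * h) \<omega> + 0 * h"
    interpret R: random_walk M "gauss 0 (sqrt h)" ?D
      using random_walk_increments[OF h(1), of 0] by simp
    have walk: "(\<integral>\<omega>. (\<Prod>j<Suc n. decay l h (\<Sum>i<j. ?D i \<omega>)) *\<^sub>R swap_kernel g s (\<Sum>i<Suc n. ?D i \<omega>) 0 \<partial>M)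
        = (walk_step (decay l h) (gauss 0 (sqrt h)) ^^ Suc n) (\<lambda>x. swap_kernel g s x 0) 0"
      using h(1) by (intro R.expectation_walk[OF _ _ _ kernel_meas norm_swap_kernel_le[OF s(2)]]) auto
    have endpoint: "(\<integral>\<omega>. swap_kernel g s 0 (\<Sum>i<Suc n. ?D i \<omega>) \<partial>M) = ?I"
      by (intro Bochner_Integration.integral_cong refl) (simp only: sum_increments h(2), simp)
    have "norm ((\<integral>\<omega>. (\<Prod>j<Suc n. decay l h (\<Sum>i<j. ?D i \<omega>)) *\<^sub>R swap_kernel g s (\<Sum>i<Suc n. ?D i \<omega>) 0 \<partial>M)
        - (\<integral>\<omega>. swap_kernel g s 0 (\<Sum>i<Suc n. ?D i \<omega>) \<partial>M))
        \<le> real (Suc n) * (C1 * h\<^sup>2 + C2 * (h * sqrt h))"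
      using h(1) by (intro R.duality[OF _ _ _ swap_kernel_measurable norm_swap_kernel_le[OF s(2)] one_step]) auto
    also have "\<dots> = C1 * (real (Suc n) * h) * h + C2 * (real (Suc n) * h) * sqrt h"
      by (simp add: algebra_simps power2_eq_square)
    finally show ?thesis
      unfolding walk endpoint h(2) by (simp only: h_def)
  qed
  have h0: "?h \<longlonglongrightarrow> 0"
    using LIMSEQ_Suc[OF lim_const_over_n[of t]] by simp
  have "(\<lambda>n. C1 * t * ?h n + C2 * t * sqrt (?h n)) \<longlonglongrightarrow> C1 * t * 0 + C2 * t * sqrt 0"
    by (intro tendsto_intros h0)
  hence "(\<lambda>n. ?a n - ?I) \<longlonglongrightarrow> 0"
    by (intro Lim_null_comparison[OF always_eventually[OF allI[OF err]]]) simp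
  hence lim2: "?a \<longlonglongrightarrow> ?I"
    by (simp only: LIM_zero_iff)
  from LIMSEQ_unique[OF lim1 lim2]
  have "?I = (\<integral>\<omega>. complex_of_real (exp_functional 0 l t \<omega> * exp (- (g * exp (B t \<omega>)))) \<partial>M)"
    by (simp only: swap_kernel_zero scaleR_conv_of_real of_real_mult)
  thus ?thesis
    by (simp only: integral_complex_of_real)
qed

end

section \<open>Differentiating Laplace transforms\<close>

lemma exp_second_order_bound:
  fixes u :: real
  shows "\<bar>exp (- u) - 1 + u\<bar> \<le> u\<^sup>2 * exp \<bar>u\<bar>"
proof (cases "u \<ge> 0")
  case True
  have "u\<^sup>2 * 1 \<le> u\<^sup>2 * exp \<bar>u\<bar>"
    by (intro mult_left_mono) auto
  thus ?thesis
    using exp_neg_remainder(2)[OF True] by linarith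
next
  case False
  define v where "v = - u"
  have v: "v \<ge> 0" using False by (simp add: v_def)
  have "(1 - v) * (1 + v) \<le> exp (- v) * (1 + v)"
    using exp_ge_add_one_self[of "- v"] v by (intro mult_right_mono) auto
  hence "exp v * ((1 - v) * (1 + v)) \<le> exp v * (exp (- v) * (1 + v))"
    by (intro mult_left_mono) auto
  also have "\<dots> = 1 + v"
    by (simp flip: mult.assoc exp_add)
  finally have "exp v - 1 - v \<le> v\<^sup>2 * exp v"
    by (simp add: algebra_simps power2_eq_square)
  moreover have "0 \<le> exp v - 1 - v"
    using exp_ge_add_one_self[of v] by linarith
  ultimately show ?thesis
    using v by (simp add: v_def)
qed

lemma (in prob_space) Laplace_moment_integrable:
  fixes X W :: "'a \<Rightarrow> real"
  assumes [measurable]: "X \<in> borel_measurable M" "W \<in> borel_measurable M"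
    and X: "\<And>\<omega>. 0 \<le> X \<omega>" and W: "\<And>\<omega>. 0 \<le> W \<omega>" "\<And>\<omega>. W \<omega> \<le> 1" and g: "g > 0"
  shows "integrable M (\<lambda>\<omega>. W \<omega> * (X \<omega> ^ j * exp (- (g * X \<omega>))))"
    and "(\<integral>\<omega>. W \<omega> * (X \<omega> ^ j * exp (- (g * X \<omega>))) \<partial>M) \<le> fact j / g ^ j"
proof -
  have bound: "norm (W \<omega> * (X \<omega> ^ j * exp (- (g * X \<omega>)))) \<le> 1 * (fact j / g ^ j)" for \<omega>
    unfolding norm_mult[of "W \<omega>"]
    using W[of \<omega>] X[of \<omega>] power_times_exp_le[OF X g, of \<omega> j] by (intro mult_mono) auto
  show int: "integrable M (\<lambda>\<omega>. W \<omega> * (X \<omega> ^ j * exp (- (g * X \<omega>))))"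
    using bound by (intro integrable_const_bound[where B = "fact j / g ^ j"]) auto
  have "(\<integral>\<omega>. W \<omega> * (X \<omega> ^ j * exp (- (g * X \<omega>))) \<partial>M) \<le> (\<integral>\<omega>. fact j / g ^ j \<partial>M)"
    using bound by (intro integral_mono int) (auto simp: abs_le_iff)
  thus "(\<integral>\<omega>. W \<omega> * (X \<omega> ^ j * exp (- (g * X \<omega>))) \<partial>M) \<le> fact j / g ^ j"
    by (simp add: prob_space)
qed

text \<open>
  The second-order remainder of \<open>exp (- (g + d) X)\<close> in \<open>d\<close> is at most
  \<open>d\<^sup>2 X\<^sup>2 exp (- (g / 2) X)\<close> for \<open>\<bar>d\<bar> < g / 2\<close>; after multiplication by \<open>X\<^sup>j\<close> this
  has bounded expectation, because \<open>X\<^sup>m exp (- (g / 2) X)\<close> is at most a constant.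
\<close>

lemma (in prob_space) Laplace_moment_derivative:
  fixes X W :: "'a \<Rightarrow> real"
  assumes meas [measurable]: "X \<in> borel_measurable M" "W \<in> borel_measurable M"
    and X: "\<And>\<omega>. 0 \<le> X \<omega>" and W: "\<And>\<omega>. 0 \<le> W \<omega>" "\<And>\<omega>. W \<omega> \<le> 1" and g: "g > 0"
  shows "((\<lambda>g. \<integral>\<omega>. W \<omega> * (X \<omega> ^ j * exp (- (g * X \<omega>))) \<partial>M) has_real_derivative
    - (\<integral>\<omega>. W \<omega> * (X \<omega> ^ Suc j * exp (- (g * X \<omega>))) \<partial>M)) (at g)"
proof -
  define G where "G = (\<lambda>j g. \<integral>\<omega>. W \<omega> * (X \<omega> ^ j * exp (- (g * X \<omega>))) \<partial>M)"
  define C where "C = fact (j + 2) / (g / 2) ^ (j + 2)"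
  note int = Laplace_moment_integrable(1)[OF meas X W]
  have remainder: "\<bar>G j (g + d) - G j g + d * G (Suc j) g\<bar> \<le> d\<^sup>2 * C" if d: "\<bar>d\<bar> < g / 2" for d
  proof -
    have gd: "g + d > 0" "g / 2 > 0"
      using d g by auto
    define r where "r = (\<lambda>\<omega>. W \<omega> * (X \<omega> ^ j * exp (- ((g + d) * X \<omega>))) - W \<omega> * (X \<omega> ^ j * exp (- (g * X \<omega>)))
        + d * (W \<omega> * (X \<omega> ^ Suc j * exp (- (g * X \<omega>)))))"
    have eq: "G j (g + d) - G j g + d * G (Suc j) g = (\<integral>\<omega>. r \<omega> \<partial>M)"
      using int[OF g] int[OF gd(1)] by (simp add: G_def r_def del: power_Suc)
    have "\<bar>G j (g + d) - G j g + d * G (Suc j) g\<bar> \<le> (\<integral>\<omega>. \<bar>r \<omega>\<bar> \<partial>M)"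
      unfolding eq by (rule integral_abs_bound)
    also have "\<dots> \<le> (\<integral>\<omega>. d\<^sup>2 * (W \<omega> * (X \<omega> ^ (j + 2) * exp (- (g / 2 * X \<omega>)))) \<partial>M)"
    proof (rule integral_mono)
      show "integrable M (\<lambda>\<omega>. \<bar>r \<omega>\<bar>)"
        unfolding r_def
        by (intro integrable_abs Bochner_Integration.integrable_add Bochner_Integration.integrable_diff
            integrable_mult_right int g gd)
      show "integrable M (\<lambda>\<omega>. d\<^sup>2 * (W \<omega> * (X \<omega> ^ (j + 2) * exp (- (g / 2 * X \<omega>)))))"
        by (intro integrable_mult_right int gd)
      fix \<omega>
      have "\<bar>r \<omega>\<bar> = \<bar>W \<omega> * X \<omega> ^ j * exp (- (g * X \<omega>)) * (exp (- (d * X \<omega>)) - 1 + d * X \<omega>)\<bar>"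
      proof -
        have "exp (- ((g + d) * X \<omega>)) = exp (- (g * X \<omega>)) * exp (- (d * X \<omega>))"
          by (simp add: algebra_simps flip: exp_add)
        thus ?thesis by (simp add: r_def algebra_simps)
      qed
      also have "\<dots> = W \<omega> * X \<omega> ^ j * exp (- (g * X \<omega>)) * \<bar>exp (- (d * X \<omega>)) - 1 + d * X \<omega>\<bar>"
        using W(1)[of \<omega>] X[of \<omega>] by (simp add: abs_mult)
      also have "\<dots> \<le> W \<omega> * X \<omega> ^ j * exp (- (g * X \<omega>)) * ((d * X \<omega>)\<^sup>2 * exp (g / 2 * X \<omega>))"
      proof (rule mult_left_mono)
        have "\<bar>d * X \<omega>\<bar> \<le> g / 2 * X \<omega>"
          using d X[of \<omega>] unfolding abs_mult by (intro mult_mono) auto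
        hence "(d * X \<omega>)\<^sup>2 * exp \<bar>d * X \<omega>\<bar> \<le> (d * X \<omega>)\<^sup>2 * exp (g / 2 * X \<omega>)"
          by (intro mult_left_mono) auto
        thus "\<bar>exp (- (d * X \<omega>)) - 1 + d * X \<omega>\<bar> \<le> (d * X \<omega>)\<^sup>2 * exp (g / 2 * X \<omega>)"
          using exp_second_order_bound[of "d * X \<omega>"] by (rule order_trans[rotated])
      qed (use W(1)[of \<omega>] X[of \<omega>] in auto)
      also have "\<dots> = d\<^sup>2 * (W \<omega> * (X \<omega> ^ (j + 2) * (exp (- (g * X \<omega>)) * exp (g / 2 * X \<omega>))))"
        by (simp add: power_add power_mult_distrib power2_eq_square algebra_simps)
      also have "exp (- (g * X \<omega>)) * exp (g / 2 * X \<omega>) = exp (- (g / 2 * X \<omega>))"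
        by (simp flip: exp_add)
      finally show "\<bar>r \<omega>\<bar> \<le> d\<^sup>2 * (W \<omega> * (X \<omega> ^ (j + 2) * exp (- (g / 2 * X \<omega>))))" .
    qed
    also have "\<dots> \<le> d\<^sup>2 * C"
      unfolding C_def using Laplace_moment_integrable(2)[OF meas X W gd(2), of "j + 2"]
      by (simp only: integral_mult_right_zero) (intro mult_left_mono, auto)
    finally show ?thesis .
  qed
  have "\<forall>\<^sub>F d in at 0. norm ((G j (g + d) - G j g) / d - - G (Suc j) g) \<le> \<bar>d\<bar> * C"
    unfolding eventually_at
  proof (intro exI[of _ "g / 2"] conjI ballI impI)
    fix d :: real
    assume "d \<noteq> 0 \<and> dist d 0 < g / 2"
    hence d: "d \<noteq> 0" "\<bar>d\<bar> < g / 2" by auto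
    have "(G j (g + d) - G j g) / d - - G (Suc j) g = (G j (g + d) - G j g + d * G (Suc j) g) / d"
      using d(1) by (simp add: field_simps)
    also have "norm \<dots> \<le> d\<^sup>2 * C / \<bar>d\<bar>"
      using remainder[OF d(2)] by (simp add: divide_right_mono)
    also have "\<dots> = \<bar>d\<bar> * C"
      using d(1) by (simp add: power2_eq_square abs_if field_simps)
    finally show "norm ((G j (g + d) - G j g) / d - - G (Suc j) g) \<le> \<bar>d\<bar> * C" .
  qed (use g in auto)
  moreover have "((\<lambda>d. \<bar>d\<bar> * C) \<longlongrightarrow> 0) (at 0)"
    by (auto intro!: tendsto_eq_intros)
  ultimately have "((\<lambda>d. (G j (g + d) - G j g) / d - - G (Suc j) g) \<longlongrightarrow> 0) (at 0)"
    by (rule Lim_null_comparison)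
  hence "((\<lambda>d. (G j (g + d) - G j g) / d) \<longlongrightarrow> - G (Suc j) g) (at 0)"
    by (simp only: LIM_zero_iff)
  thus ?thesis
    unfolding DERIV_def G_def .
qed

text \<open>
  The hypotheses hold on the half-line \<open>x > 0\<close> only.  That is enough for derivatives of all orders,
  since each of them depends on the values near \<open>x\<close>.
\<close>

lemma nth_vector_derivative_alternating:
  fixes f :: "real \<Rightarrow> complex" and F :: "nat \<Rightarrow> real \<Rightarrow> real"
  assumes f: "\<And>x. x > 0 \<Longrightarrow> f x = of_real (F 0 x)"
    and F: "\<And>j x. x > 0 \<Longrightarrow> (F j has_real_derivative - F (Suc j) x) (at x)"
    and x: "x > 0"
  shows "nth_vector_derivative j f x = (-1) ^ j * of_real (F j x)"
    and "nth_vector_derivative j f differentiable (at x)"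
proof -
  have step: "(nth_vector_derivative j f has_vector_derivative (-1) ^ Suc j * of_real (F (Suc j) x)) (at x)"
    if eq: "\<And>x. x > 0 \<Longrightarrow> nth_vector_derivative j f x = (-1) ^ j * of_real (F j x)" and x: "x > 0" for j x
  proof (rule has_vector_derivative_transform_within_open)
    have "((\<lambda>x. complex_of_real (F j x)) has_vector_derivative of_real (- F (Suc j) x)) (at x)"
      using F[OF x] by (intro has_vector_derivative_of_real)
        (simp add: has_real_derivative_iff_has_vector_derivative)
    from has_vector_derivative_mult_right[OF this, of "(-1) ^ j"]
    show "((\<lambda>x. (-1) ^ j * complex_of_real (F j x)) has_vector_derivative
        (-1) ^ Suc j * of_real (F (Suc j) x)) (at x)"
      by simp
    show "open {0::real<..}" "x \<in> {0<..}" using x by auto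
  qed (use eq in auto)
  have eq: "\<And>x. x > 0 \<Longrightarrow> nth_vector_derivative j f x = (-1) ^ j * of_real (F j x)" for j
  proof (induction j)
    case 0
    thus ?case by (simp add: nth_vector_derivative_def f)
  next
    case (Suc j)
    have "nth_vector_derivative (Suc j) f x = vector_derivative (nth_vector_derivative j f) (at x)"
      by (simp add: nth_vector_derivative_def)
    thus ?case
      using vector_derivative_at[OF step[OF Suc.IH Suc.prems]] by simp
  qed
  show "nth_vector_derivative j f x = (-1) ^ j * of_real (F j x)"
    by (rule eq[OF x])
  show "nth_vector_derivative j f differentiable (at x)"
    using step[OF eq x] by (rule differentiableI_vector)
qed


section \<open>The hyperbolic kernel and the derivative formula\<close>

text \<open>
  With the principal branches, \<open>exp (arcosh y) = y + r\<close> and \<open>exp (- arcosh y) = y - r\<close> where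
  \<open>r\<^sup>2 = y\<^sup>2 - 1\<close>, so the addition theorem for \<open>cosh\<close> applies and \<open>s = l r\<close>.  As \<open>s\<^sup>2\<close> is real, \<open>s\<close> is
  either imaginary or real with \<open>s\<^sup>2 = g\<^sup>2 - l\<^sup>2 < g\<^sup>2\<close>.
\<close>

lemma cosh_kernel_eq_swap_kernel:
  assumes l: "l > 0" and g: "g > 0"
  obtains s where "s\<^sup>2 = complex_of_real (g\<^sup>2 - l\<^sup>2)" "\<bar>Re s\<bar> < g" "\<And>x. cosh_kernel l x g = swap_kernel g s 0 x"
proof
  define y where "y = complex_of_real (g / l)"
  define r where "r = (y\<^sup>2 - 1) powr of_real (1 / 2)"
  define s where "s = of_real l * r"
  have r2: "r\<^sup>2 = y\<^sup>2 - 1"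
    by (simp add: r_def powr_def power2_eq_square flip: exp_add)
  have unit: "(y + r) * (y - r) = 1"
    using r2 by (simp add: algebra_simps power2_eq_square)
  hence nz: "y + r \<noteq> 0" by auto
  have e: "exp (arcosh y) = y + r"
    using nz by (simp add: arcosh_def r_def)
  have e': "exp (- arcosh y) = y - r"
    using unit nz by (simp add: exp_minus e field_simps)
  have "cosh (arcosh y) = y" "sinh (arcosh y) = r"
    by (simp_all add: cosh_field_def sinh_field_def e e')
  hence add: "cosh (arcosh y + of_real x) = y * of_real (cosh x) + r * of_real (sinh x)" for x
    by (simp add: cosh_add cosh_complex_of_real sinh_complex_of_real)
  show "cosh_kernel l x g = swap_kernel g s 0 x" for x
  proof -
    have "of_real l * y = complex_of_real g"
      using l by (simp add: y_def)
    hence "- of_real l * (y * of_real (cosh x) + r * of_real (sinh x))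
        = - (of_real (exp 0) * (of_real (g * cosh x) + s * of_real (sinh x)))"
      by (simp add: s_def algebra_simps)
    thus ?thesis
      unfolding cosh_kernel_def swap_kernel_def y_def[symmetric] add by (rule arg_cong)
  qed
  have "s\<^sup>2 = of_real (l\<^sup>2) * (y\<^sup>2 - 1)"
    by (simp add: s_def power_mult_distrib r2)
  also have "\<dots> = of_real (g\<^sup>2 - l\<^sup>2)"
    using l by (simp add: y_def field_simps power_divide)
  finally show s2: "s\<^sup>2 = complex_of_real (g\<^sup>2 - l\<^sup>2)" .
  have re: "(Re s)\<^sup>2 - (Im s)\<^sup>2 = g\<^sup>2 - l\<^sup>2" and im: "Re s * Im s = 0"
    using arg_cong[OF s2, of Re] arg_cong[OF s2, of Im] by (auto simp: power2_eq_square)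
  show "\<bar>Re s\<bar> < g"
  proof (cases "Re s = 0")
    case False
    hence "\<bar>Re s\<bar>\<^sup>2 < g\<^sup>2"
      using re im l by simp
    thus ?thesis
      by (rule power2_less_imp_less) (use g in simp)
  qed (use g in simp)
qed

theorem proposition2p7:
  fixes M :: "'a measure" and B Y :: "real \<Rightarrow> 'a \<Rightarrow> real"
    and k :: nat and t l \<gamma> :: real
  assumes "standard_brownian_motion M B"
    and "t \<ge> 0"
    and "\<And>u \<omega>. Y u \<omega> = exp (B u \<omega> + real k * u)"
    and "l > 0" and "\<gamma> > 0"
  shows "(\<forall>\<omega>\<in>space M. set_integrable lborel {0..t} (\<lambda>u. (Y u \<omega>)\<^sup>2))
    \<and> integrable M (\<lambda>\<omega>. exp (- \<gamma> * Y t \<omega> - l\<^sup>2 / 2 * (LINT u:{0..t}|lborel. (Y u \<omega>)\<^sup>2)))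
    \<and> integrable M (\<lambda>\<omega>. cosh_kernel l (B t \<omega>) \<gamma>)
    \<and> (\<forall>j<k. nth_vector_derivative j (\<lambda>g. cosh_transform M (B t) g l) differentiable (at \<gamma>))
    \<and> complex_of_real (LINT \<omega>|M. exp (- \<gamma> * Y t \<omega> - l\<^sup>2 / 2 * (LINT u:{0..t}|lborel. (Y u \<omega>)\<^sup>2)))
      = (-1) ^ k * complex_of_real (exp (- ((real k)\<^sup>2 / 2 * t)))
          * nth_vector_derivative k (\<lambda>g. cosh_transform M (B t) g l) \<gamma>"
proof -
  interpret brownian_motion M B
    by unfold_locales (rule assms(1))
  note t = assms(2) and Y = assms(3) and l = assms(4) and \<gamma> = assms(5)
  define F where "F = (\<lambda>j g. \<integral>\<omega>. exp_functional 0 l t \<omega> * (exp (B t \<omega>) ^ j * exp (- (g * exp (B t \<omega>)))) \<partial>M)"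
  define f where "f = (\<lambda>x. exp (- (\<gamma> * exp x)))"
  have [measurable]: "B t \<in> borel_measurable M" "exp_functional c l t \<in> borel_measurable M" for c
    using t by measurable
  have f: "f \<in> borel_measurable borel" "norm (f x) \<le> 1" for x
    using \<gamma> by (simp_all add: f_def)
  note [measurable] = f(1)
  have Y2: "(Y u \<omega>)\<^sup>2 = exp (2 * (B u \<omega> + real k * u))" for u \<omega>
    by (simp only: Y exp_double)
  have functional: "exp (- \<gamma> * Y t \<omega> - l\<^sup>2 / 2 * (LINT u:{0..t}|lborel. (Y u \<omega>)\<^sup>2))
      = exp_functional (real k) l t \<omega> * f (B t \<omega> + real k * t)" for \<omega>
    by (simp add: exp_functional_def f_def Y2 Y[of t] flip: exp_add)
  have ef: "norm (exp (real k * x) * f x) \<le> fact k / \<gamma> ^ k" for x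
    using power_times_exp_le[of "exp x" \<gamma> k] \<gamma> by (simp add: f_def exp_of_nat_mult)
  have paths: "set_integrable lborel {0..t} (\<lambda>u. (Y u \<omega>)\<^sup>2)" if "\<omega> \<in> space M" for \<omega>
  proof -
    have "continuous_on {0..t} (\<lambda>u. B u \<omega>)"
      by (rule continuous_on_subset[OF continuous_B[OF that]]) auto
    hence "continuous_on {0..t} (\<lambda>u. (Y u \<omega>)\<^sup>2)"
      unfolding Y2 by (intro continuous_intros)
    thus ?thesis by (rule borel_integrable_atLeastAtMost')
  qed
  have lhs: "integrable M (\<lambda>\<omega>. exp (- \<gamma> * Y t \<omega> - l\<^sup>2 / 2 * (LINT u:{0..t}|lborel. (Y u \<omega>)\<^sup>2)))"
    unfolding functional
  proof (rule integrable_const_bound[where B = 1])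
    have "exp_functional (real k) l t \<omega> * norm (f (B t \<omega> + real k * t)) \<le> 1 * 1" for \<omega>
      by (intro mult_mono exp_functional_bounds f(2)) auto
    thus "AE \<omega> in M. norm (exp_functional (real k) l t \<omega> * f (B t \<omega> + real k * t)) \<le> 1"
      by (simp add: abs_mult exp_functional_bounds)
  qed measurable
  have kernel: "integrable M (\<lambda>\<omega>. cosh_kernel l (B t \<omega>) \<gamma>)"
  proof -
    obtain s where s: "\<bar>Re s\<bar> < \<gamma>" "\<And>x. cosh_kernel l x \<gamma> = swap_kernel \<gamma> s 0 x"
      by (rule cosh_kernel_eq_swap_kernel[OF l \<gamma>]) blast
    show ?thesis
      unfolding s(2) by (rule integrable_const_bound[where B = 1]) (use norm_swap_kernel_le[OF s(1)] in auto)
  qed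
  have transform: "cosh_transform M (B t) g l = of_real (F 0 g)" if g: "g > 0" for g
  proof -
    obtain s where s: "s\<^sup>2 = complex_of_real (g\<^sup>2 - l\<^sup>2)" "\<bar>Re s\<bar> < g"
      "\<And>x. cosh_kernel l x g = swap_kernel g s 0 x"
      by (rule cosh_kernel_eq_swap_kernel[OF l g]) blast
    show ?thesis
      using exp_functional_swap[OF t s(1,2)] by (simp add: cosh_transform_def s(3) F_def)
  qed
  have derivative: "(F j has_real_derivative - F (Suc j) g) (at g)" if "g > 0" for j g
    unfolding F_def using that by (intro Laplace_moment_derivative exp_functional_bounds) auto
  have nth: "nth_vector_derivative j (\<lambda>g. cosh_transform M (B t) g l) \<gamma> = (-1) ^ j * of_real (F j \<gamma>)"
    and smooth: "nth_vector_derivative j (\<lambda>g. cosh_transform M (B t) g l) differentiable (at \<gamma>)" for j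
    by (rule nth_vector_derivative_alternating[where F = F], use transform derivative \<gamma> in auto)+
  have "(\<integral>\<omega>. exp_functional (real k) l t \<omega> * f (B t \<omega> + real k * t) \<partial>M)
      = exp (- ((real k)\<^sup>2 * t / 2)) * (\<integral>\<omega>. exp_functional 0 l t \<omega> * (exp (real k * B t \<omega>) * f (B t \<omega>)) \<partial>M)"
    by (rule exp_functional_Cameron_Martin[OF t f ef])
  also have "\<dots> = exp (- ((real k)\<^sup>2 / 2 * t)) * F k \<gamma>"
    by (simp add: F_def f_def exp_of_nat_mult)
  finally have formula: "complex_of_real (LINT \<omega>|M. exp (- \<gamma> * Y t \<omega> - l\<^sup>2 / 2 * (LINT u:{0..t}|lborel. (Y u \<omega>)\<^sup>2)))
      = (-1) ^ k * complex_of_real (exp (- ((real k)\<^sup>2 / 2 * t)))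
          * nth_vector_derivative k (\<lambda>g. cosh_transform M (B t) g l) \<gamma>"
    unfolding functional nth by (simp add: mult.assoc mult.left_commute flip: power_mult_distrib)
  show ?thesis
    using paths lhs kernel smooth formula by blast
qed

end
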